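(* Let $(\Omega,\mathcal F,(\mathcal F_t)_{t=0}^T,P)$ be a complete filtered probability space, let $Z=(Z_t)_{t=0}^T$ be an adapted $\mathbb R^{d-1}$-valued process (marginal prices of $d-1$ risky assets), and for each $t=0,\ldots,T$ let $G_t:\mathbb R^{d-1}\times\Omega\to\mathbb R_+$ be an $\mathcal F_t$-normal integrand, convex in its first argument, such that $$\lim_{\alpha\to\infty}\frac{G_t(\alpha z,\omega)}{\alpha}\ge -Z_t(\omega)\cdot z\quad\forall z\in\mathbb R^{d-1},\qquad \lim_{\alpha\to\infty}\frac{G_t(\alpha z,\omega)}{\alpha}> -Z_t(\omega)\cdot z\quad\forall z\notin\mathbb R^{d-1}_-.$$ Let $W$ be a real-valued random variable (random endowment), and let $u:\mathbb R\to\mathbb R$ be a (possibly nonconcave) utility function that is upper semicontinuous, bounded from above and satisfies $$\limsup_{\alpha\to\infty}\frac{u(\alpha w)}{\alpha}<0\quad\forall w<0.$$ Consider an investor with initial capital $X_0^0=z\in\mathbb R$ and zero initial stock position $\phi_0=0$. A trading strategy is a predictable $\mathbb R^{d-1}$-valued process $\phi=(\phi_t)_{t=1}^{T+1}$ with $\phi_{T+1}=0$ (terminal liquidation at time $T$), and its terminal cash position is $$X^0(\phi):=X_0^0-\sum_{t=0}^{T}\Delta\phi_{t+1}\cdot Z_t-\sum_{t=0}^{T}G_t(\Delta\phi_{t+1}),\qquad \Delta\phi_{t+1}:=\phi_{t+1}-\phi_t .$$ Then there exists an optimal strategy $\phi^*$, i.e. a trading strategy with $$\sup_\phi Eu\big(X^0(\phi)+W\big)=Eu\big(X^0(\phi^*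 )+W\big),$$ where the supremum is over all trading strategies $\phi$.
   Context: An $\mathcal F_t$-normal integrand is a $\mathcal B(\mathbb R^{d-1})\otimes\mathcal F_t$-measurable function $G_t$ such that $G_t(\cdot,\omega)$ is lower semicontinuous for every $\omega$; properties of normal integrands are understood $P$-almost surely. $\phi$ predictable means that $\phi_t$ is $\mathcal F_{t-1}$-measurable for each $t$; $\phi_t$ is the portfolio of risky assets held over $(t-1,t]$, so $\Delta\phi_{t+1}$ is the portfolio of risky assets bought at time $t$, for which the investor pays $\Delta\phi_{t+1}\cdot Z_t+G_t(\Delta\phi_{t+1})$ in cash ($G_t$ being the illiquidity cost). The riskless asset has price identically $1$. The expectation $Eu(\cdot)$ is well-defined in $[-\infty,\infty)$ since $u$ is bounded from above. *)

theory Defs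
  imports "HOL-Probability.Probability"
begin

definition lower_semicontinuous :: "('a::topological_space \<Rightarrow> real) \<Rightarrow> bool" where
  "lower_semicontinuous f \<longleftrightarrow> (\<forall>x c. c < f x \<longrightarrow> (\<forall>\<^sub>F y in nhds x. c < f y))"

definition upper_semicontinuous :: "('a::topological_space \<Rightarrow> real) \<Rightarrow> bool" where
  "upper_semicontinuous f \<longleftrightarrow> (\<forall>x c. f x < c \<longrightarrow> (\<forall>\<^sub>F y in nhds x. f y < c))"

locale complete_filtered_prob_space = prob_space M + complete_measure M
  for M :: "'w measure" +
  fixes F :: "nat \<Rightarrow> 'w measure" and T :: nat
  assumes subalgebra_F: "t \<le> T \<Longrightarrow> subalgebra M (F t)"
    and sets_F_mono: "s \<le> t \<Longrightarrow> t \<le> T \<Longrightarrow> sets (F s) \<subseteq> sets (F t)"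
    and null_sets_F: "null_sets M \<subseteq> sets (F 0)"

definition normal_integrand ::
  "'w measure \<Rightarrow> ('a::topological_space \<Rightarrow> 'w \<Rightarrow> real) \<Rightarrow> bool" where
  "normal_integrand N G \<longleftrightarrow>
     (\<lambda>(x, \<omega>). G x \<omega>) \<in> borel_measurable (borel \<Otimes>\<^sub>M N) \<and>
     (\<forall>\<omega>\<in>space N. lower_semicontinuous (\<lambda>x. G x \<omega>))"

(* The limit may be infinite.  Lim is a definite description; for convex g the limit
   always exists in the extended reals, since (g (\<alpha> z) - g 0) / \<alpha> is
   nondecreasing in \<alpha>. *)
definition asymptotic_slope :: "('a::real_vector \<Rightarrow> real) \<Rightarrow> 'a \<Rightarrow> ereal" where
  "asymptotic_slope g z = Lim at_top (\<lambda>\<alpha>::real. ereal (g (\<alpha> *\<^sub>R z) / \<alpha>))"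

definition nonpos_orthant :: "(real ^ 'n) set" where
  "nonpos_orthant = {z. \<forall>i. z $ i \<le> 0}"

(* Time runs over {1..T+1}; the convention \<phi> 0 = 0 is the zero initial stock position.
   Values beyond T + 1 are irrelevant. *)
definition trading_strategies ::
  "'w measure \<Rightarrow> (nat \<Rightarrow> 'w measure) \<Rightarrow> nat \<Rightarrow> (nat \<Rightarrow> 'w \<Rightarrow> real ^ 'n) set" where
  "trading_strategies M F T = {\<phi>.
     (\<forall>t\<in>{1..T + 1}. \<phi> t \<in> borel_measurable (F (t - 1))) \<and>
     (\<forall>\<omega>\<in>space M. \<phi> 0 \<omega> = 0 \<and> \<phi> (T + 1) \<omega> = 0)}"

definition terminal_cash ::
  "real \<Rightarrow> (nat \<Rightarrow> 'w \<Rightarrow> real ^ 'n) \<Rightarrow> (nat \<Rightarrow> real ^ 'n \<Rightarrow> 'w \<Rightarrow> real) \<Rightarrow> nat \<Rightarrow>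
   (nat \<Rightarrow> 'w \<Rightarrow> real ^ 'n) \<Rightarrow> 'w \<Rightarrow> real" where
  "terminal_cash x0 Z G T \<phi> \<omega> =
     x0 - (\<Sum>t=0..T. (\<phi> (t + 1) \<omega> - \<phi> t \<omega>) \<bullet> Z t \<omega>)
        - (\<Sum>t=0..T. G t (\<phi> (t + 1) \<omega> - \<phi> t \<omega>) \<omega>)"

(* The library's Bochner integral is 0 for non-integrable functions, so the expectation
   E[Y] = E[Y+] - E[Y-] is taken in the extended reals.  For Y bounded from above on a
   probability space E[Y+] is finite and the value lies in [-\<infinity>, \<infinity>);
   ennreal maps negative reals to 0, hence it computes the positive and negative parts. *)
definition extended_expectation :: "'w measure \<Rightarrow> ('w \<Rightarrow> real) \<Rightarrow> ereal" where
  "extended_expectation M Y =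
     enn2ereal (\<integral>\<^sup>+ \<omega>. ennreal (Y \<omega>) \<partial>M) - enn2ereal (\<integral>\<^sup>+ \<omega>. ennreal (- Y \<omega>) \<partial>M)"

end

theory Submission
  imports Defs
begin

text \<open>Minimise the expectation of the nonnegative loss \<open>C - u (wealth)\<close> by dynamic programming, where
  \<open>C\<close> bounds \<open>u\<close>. By the slope conditions a trade that is unbounded along a path costs an
  unbounded amount along that path: a direction without cost would consist of sales only, and trades
  add up to 0. Hence the loss is coercive and lower semicontinuous in the strategy, path by path.
  Conditional expectations preserve both properties by Fatou's lemma. A minimum over
  the last portfolio is attained, because a minimising sequence converges along a random subsequence
  whose indices are measurable with respect to the information at hand, and the same compactness
  argument shows that the minimal value again has both properties. No convexity of the loss in the
  strategy is needed, which is why \<open>u\<close> may be nonconcave.\<close>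

subsection \<open>Coercive lower semicontinuous random functionals\<close>

text \<open>The obstacle is that every property of the loss holds only almost surely, with a null
  set that depends on the strategies, while the competitors form an uncountable family. Two devices
  take its place: each passage to a limit involves a single sequence of tuples, and the minimum is
  found by maximising the integral of the bounded quantity \<open>inverse (1 + J)\<close>, for which
  a sequence of competitors suffices. Losses live in [0,\<infinity>] throughout. Conditioning may
  produce the value \<infinity> although the loss is finite on every path, and a problem in which
  every strategy has expected utility -\<infinity> is covered by the same argument.\<close>

lemma LIMSEQ_iff_inverse_Suc:
  fixes x :: "nat \<Rightarrow> 'a::metric_space"
  shows "x \<longlonglongrightarrow> l \<longleftrightarrow> (\<forall>k::nat. \<exists>N. \<forall>n\<ge>N. dist (x n) l < 1 / Suc k)" (is "_ = ?R")
proof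
  assume "x \<longlonglongrightarrow> l"
  then show ?R
    by (intro allI metric_LIMSEQ_D) auto
next
  assume R: ?R
  show "x \<longlonglongrightarrow> l"
  proof (rule metric_LIMSEQ_I)
    fix e :: real assume "0 < e"
    then obtain k where k: "1 / Suc k < e" by (rule nat_approx_posE)
    obtain N where "\<forall>n\<ge>N. dist (x n) l < 1 / Suc k" using R by blast
    then show "\<exists>N. \<forall>n\<ge>N. dist (x n) l < e" using k by (intro exI[of _ N]) fastforce
  qed
qed

lemma filterlim_at_top_iff_nat:
  fixes x :: "nat \<Rightarrow> real"
  shows "filterlim x at_top sequentially \<longleftrightarrow> (\<forall>k::nat. \<exists>N. \<forall>n\<ge>N. real k \<le> x n)" (is "_ = ?R")
proof
  assume "filterlim x at_top sequentially"
  then show ?R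
    by (auto simp: filterlim_at_top eventually_sequentially)
next
  assume R: ?R
  show "filterlim x at_top sequentially"
    unfolding filterlim_at_top eventually_sequentially
  proof
    fix z :: real
    obtain k where "z \<le> real k" using real_arch_simple by blast
    moreover obtain N where "\<forall>n\<ge>N. real k \<le> x n" using R by blast
    ultimately show "\<exists>N. \<forall>n\<ge>N. z \<le> x n" by (intro exI[of _ N]) fastforce
  qed
qed

text \<open>Entries with index \<open>m\<close> or larger are arbitrary; that a functional does not
  see them, up to a null set, will follow from locality.\<close>

definition tuples :: "'w measure \<Rightarrow> nat \<Rightarrow> (nat \<Rightarrow> 'w \<Rightarrow> 'a::topological_space) set" where
  "tuples N m = {X. \<forall>i<m. X i \<in> borel_measurable N}"

text \<open>\<open>J\<close> acts on tuples of random vectors rather than on points, and all exceptional null sets may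
  depend on the tuples. This spares regular versions of conditional expectations of integrands.\<close>

definition coercive_lsc :: "'w measure \<Rightarrow> 'w measure \<Rightarrow> nat \<Rightarrow>
    ((nat \<Rightarrow> 'w \<Rightarrow> 'a::euclidean_space) \<Rightarrow> 'w \<Rightarrow> ennreal) \<Rightarrow> bool" where
  "coercive_lsc M N m J \<longleftrightarrow>
     (\<forall>X\<in>tuples N m. J X \<in> borel_measurable N) \<and>
     (\<forall>Y X. (\<forall>n. Y n \<in> tuples N m) \<longrightarrow> X \<in> tuples N m \<longrightarrow>
        (AE \<omega> in M. (\<forall>i<m. (\<lambda>n. Y n i \<omega>) \<longlonglongrightarrow> X i \<omega>) \<longrightarrow> J X \<omega> \<le> liminf (\<lambda>n. J (Y n) \<omega>))) \<and>
     (\<forall>Y. (\<forall>n. Y n \<in> tuples N m) \<longrightarrow>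
        (AE \<omega> in M. (\<exists>i<m. filterlim (\<lambda>n. norm (Y n i \<omega>)) at_top sequentially) \<longrightarrow>
           liminf (\<lambda>n. J (Y n) \<omega>) = \<top>))"

lemma coercive_lsc_measurable:
  "coercive_lsc M N m J \<Longrightarrow> X \<in> tuples N m \<Longrightarrow> J X \<in> borel_measurable N"
  unfolding coercive_lsc_def by blast

lemma coercive_lsc_liminf:
  "coercive_lsc M N m J \<Longrightarrow> (\<And>n. Y n \<in> tuples N m) \<Longrightarrow> X \<in> tuples N m \<Longrightarrow>
    AE \<omega> in M. (\<forall>i<m. (\<lambda>n. Y n i \<omega>) \<longlonglongrightarrow> X i \<omega>) \<longrightarrow> J X \<omega> \<le> liminf (\<lambda>n. J (Y n) \<omega>)"
  unfolding coercive_lsc_def by blast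

lemma coercive_lsc_top:
  "coercive_lsc M N m J \<Longrightarrow> (\<And>n. Y n \<in> tuples N m) \<Longrightarrow>
    AE \<omega> in M. (\<exists>i<m. filterlim (\<lambda>n. norm (Y n i \<omega>)) at_top sequentially) \<longrightarrow>
      liminf (\<lambda>n. J (Y n) \<omega>) = \<top>"
  unfolding coercive_lsc_def by blast

text \<open>Locality needs no separate axiom: it is lower semicontinuity along constant sequences.\<close>

lemma coercive_lsc_local:
  assumes J: "coercive_lsc M N m J" and X: "X \<in> tuples N m" and Y: "Y \<in> tuples N m"
  shows "AE \<omega> in M. (\<forall>i<m. X i \<omega> = Y i \<omega>) \<longrightarrow> J X \<omega> = J Y \<omega>"
  using coercive_lsc_liminf[OF J, of "\<lambda>_. X" Y] coercive_lsc_liminf[OF J, of "\<lambda>_. Y" X]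
  by (auto simp: X Y Liminf_const intro: antisym)

section \<open>Conditional monotone convergence and Fatou's lemma\<close>

context sigma_finite_subalgebra
begin

lemma nn_cond_exp_SUP:
  fixes f :: "nat \<Rightarrow> 'a \<Rightarrow> ennreal"
  assumes [measurable]: "\<And>n. f n \<in> borel_measurable M" and inc: "\<And>x. incseq (\<lambda>n. f n x)"
  shows "AE x in M. (SUP n. nn_cond_exp M F (f n) x) = nn_cond_exp M F (\<lambda>x. SUP n. f n x) x"
proof (rule nn_cond_exp_charact)
  have mono: "AE x in M. nn_cond_exp M F (f n) x \<le> nn_cond_exp M F (f (Suc n)) x" for n
    by (rule nn_cond_exp_mono) (use inc in \<open>auto simp: incseq_Suc_iff\<close>)
  fix A assume A: "A \<in> sets F"
  then have [measurable]: "A \<in> sets M" using subalg by (auto simp: subalgebra_def)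
  have "(\<integral>\<^sup>+ x\<in>A. (SUP n. f n x) \<partial>M) = (\<integral>\<^sup>+ x. (SUP n. indicator A x * f n x) \<partial>M)"
    by (simp add: SUP_mult_left_ennreal mult.commute)
  also have "\<dots> = (SUP n. \<integral>\<^sup>+ x. indicator A x * f n x \<partial>M)"
    by (rule nn_integral_monotone_convergence_SUP)
      (use inc in \<open>auto simp: incseq_def le_fun_def intro!: mult_left_mono\<close>)
  also have "\<dots> = (SUP n. \<integral>\<^sup>+ x. indicator A x * nn_cond_exp M F (f n) x \<partial>M)"
    by (subst nn_cond_exp_intg) (use A in auto)
  also have "\<dots> = (\<integral>\<^sup>+ x. (SUP n. indicator A x * nn_cond_exp M F (f n) x) \<partial>M)"
  proof (rule nn_integral_monotone_convergence_SUP_AE[symmetric])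
    show "AE x in M. indicator A x * nn_cond_exp M F (f n) x \<le> indicator A x * nn_cond_exp M F (f (Suc n)) x" for n
      using mono[of n] by eventually_elim (auto intro!: mult_left_mono)
  qed auto
  also have "\<dots> = (\<integral>\<^sup>+ x\<in>A. (SUP n. nn_cond_exp M F (f n) x) \<partial>M)"
    by (simp add: SUP_mult_left_ennreal mult.commute)
  finally show "(\<integral>\<^sup>+ x\<in>A. (SUP n. f n x) \<partial>M) = (\<integral>\<^sup>+ x\<in>A. (SUP n. nn_cond_exp M F (f n) x) \<partial>M)" .
qed auto

lemma nn_cond_exp_liminf:
  fixes f :: "nat \<Rightarrow> 'a \<Rightarrow> ennreal"
  assumes [measurable]: "\<And>n. f n \<in> borel_measurable M"
  shows "AE x in M. nn_cond_exp M F (\<lambda>x. liminf (\<lambda>n. f n x)) x \<le> liminf (\<lambda>n. nn_cond_exp M F (f n) x)"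
proof -
  define h where "h n x = (INF m\<in>{n..}. f m x)" for n x
  have [measurable]: "h n \<in> borel_measurable M" for n
    unfolding h_def by measurable
  have inc: "incseq (\<lambda>n. h n x)" for x
    unfolding h_def by (auto intro!: incseq_SucI INF_superset_mono)
  have "AE x in M. \<forall>n. \<forall>m\<in>{n..}. nn_cond_exp M F (h n) x \<le> nn_cond_exp M F (f m) x"
    unfolding AE_all_countable
    by (intro allI AE_ball_countable[THEN iffD2] ballI nn_cond_exp_mono AE_I2) (auto simp: h_def intro: INF_lower)
  moreover have "AE x in M. (SUP n. nn_cond_exp M F (h n) x) = nn_cond_exp M F (\<lambda>x. SUP n. h n x) x"
    by (intro nn_cond_exp_SUP inc) auto
  ultimately have "AE x in M. nn_cond_exp M F (\<lambda>x. SUP n. h n x) x \<le> liminf (\<lambda>n. nn_cond_exp M F (f n) x)"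
  proof eventually_elim
    case (elim x)
    have "(SUP n. nn_cond_exp M F (h n) x) \<le> (SUP n. INF m\<in>{n..}. nn_cond_exp M F (f m) x)"
      using elim(1) by (intro SUP_mono' INF_greatest) auto
    then show ?case
      using elim(2) by (simp add: liminf_SUP_INF)
  qed
  then show ?thesis
    by (simp add: h_def liminf_SUP_INF)
qed

text \<open>Semicontinuity and coercivity promise an inequality only on an event. If the event
  belongs to \<open>F\<close>, its indicator can be pulled out of the conditional expectation, and
  Fatou's lemma applies on that event alone.\<close>

lemma nn_cond_exp_le_liminf_on:
  fixes f :: "nat \<Rightarrow> 'a \<Rightarrow> ennreal"
  assumes [measurable]: "\<And>n. f n \<in> borel_measurable M" "g \<in> borel_measurable M"
    and A: "A \<in> sets F" and le: "AE x in M. x \<in> A \<longrightarrow> g x \<le> liminf (\<lambda>n. f n x)"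
  shows "AE x in M. x \<in> A \<longrightarrow> nn_cond_exp M F g x \<le> liminf (\<lambda>n. nn_cond_exp M F (f n) x)"
proof -
  have [measurable]: "A \<in> sets M" using A subalg by (auto simp: subalgebra_def)
  have "AE x in M. indicator A x * nn_cond_exp M F g x = nn_cond_exp M F (\<lambda>x. indicator A x * g x) x"
    by (rule nn_cond_exp_prod) (use A in auto)
  moreover have "AE x in M. nn_cond_exp M F (\<lambda>x. indicator A x * g x) x \<le> nn_cond_exp M F (\<lambda>x. liminf (\<lambda>n. f n x)) x"
    by (rule nn_cond_exp_mono) (use le in \<open>auto split: split_indicator\<close>)
  ultimately show ?thesis
    using nn_cond_exp_liminf[of f, OF assms(1)] by eventually_elim (auto split: split_indicator_asm)
qed

lemma nn_integral_nn_cond_exp: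
  assumes [measurable]: "f \<in> borel_measurable M"
  shows "(\<integral>\<^sup>+ x. nn_cond_exp M F f x \<partial>M) = (\<integral>\<^sup>+ x. f x \<partial>M)"
  using nn_cond_exp_intg[of "\<lambda>_. 1" f] by simp

end

lemma tuples_mono: "subalgebra N N' \<Longrightarrow> X \<in> tuples N' m \<Longrightarrow> X \<in> tuples N m"
  by (auto simp: tuples_def intro: measurable_from_subalg)

text \<open>The tuples are measurable for the smaller \<sigma>-algebra, hence so are the events of
  convergence and of divergence; their countable descriptions by natural numbers show this. Fatou's
  lemma on these events gives both properties, coercivity being the case where the lower bound is
  the constant \<open>\<top>\<close>.\<close>

lemma coercive_lsc_cond_exp:
  fixes J :: "(nat \<Rightarrow> 'w \<Rightarrow> 'a::euclidean_space) \<Rightarrow> 'w \<Rightarrow> ennreal"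
  assumes "sigma_finite_subalgebra M N'" and N: "subalgebra M N" "subalgebra N N'"
    and J: "coercive_lsc M N m J"
  shows "coercive_lsc M N' m (\<lambda>X. nn_cond_exp M N' (J X))"
proof -
  interpret sigma_finite_subalgebra M N' by fact
  have mem: "X \<in> tuples N m" if "X \<in> tuples N' m" for X :: "nat \<Rightarrow> 'w \<Rightarrow> 'a"
    using that N(2) by (rule tuples_mono[rotated])
  have meas: "J X \<in> borel_measurable M" if "X \<in> tuples N' m" for X
    using coercive_lsc_measurable[OF J mem[OF that]] N(1) by (rule measurable_from_subalg[rotated])
  have sp: "space N' = space M" using subalg by (simp add: subalgebra_def)
  show ?thesis
    unfolding coercive_lsc_def
  proof (intro conjI ballI allI impI)
    fix X :: "nat \<Rightarrow> 'w \<Rightarrow> 'a" and Y :: "nat \<Rightarrow> nat \<Rightarrow> 'w \<Rightarrow> 'a"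
    assume X: "X \<in> tuples N' m" and Y: "\<forall>n. Y n \<in> tuples N' m"
    have [measurable]: "X i \<in> borel_measurable N'" "Y n i \<in> borel_measurable N'" if "i < m" for i n
      using X Y that by (auto simp: tuples_def)
    define A where "A = {\<omega>\<in>space N'. \<forall>i\<in>{..<m}. (\<lambda>n. Y n i \<omega>) \<longlonglongrightarrow> X i \<omega>}"
    have "{\<omega>\<in>space N'. (\<lambda>n. Y n i \<omega>) \<longlonglongrightarrow> X i \<omega>} \<in> sets N'" if "i < m" for i
    proof -
      have "{\<omega>\<in>space N'. (\<lambda>n. Y n i \<omega>) \<longlonglongrightarrow> X i \<omega>}
          = {\<omega>\<in>space N'. \<forall>k::nat. \<exists>l. \<forall>n\<ge>l. dist (Y n i \<omega>) (X i \<omega>) < 1 / Suc k}"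
        by (simp only: LIMSEQ_iff_inverse_Suc)
      also have "\<dots> \<in> sets N'"
        using that by measurable
      finally show ?thesis .
    qed
    then have A: "A \<in> sets N'" unfolding A_def by (intro sets.sets_Collect_finite_All) auto
    have "AE \<omega> in M. \<omega> \<in> A \<longrightarrow> nn_cond_exp M N' (J X) \<omega> \<le> liminf (\<lambda>n. nn_cond_exp M N' (J (Y n)) \<omega>)"
      using coercive_lsc_liminf[OF J, of Y X] mem X Y
      by (intro nn_cond_exp_le_liminf_on A) (auto simp: A_def meas elim!: eventually_mono)
    then show "AE \<omega> in M. (\<forall>i<m. (\<lambda>n. Y n i \<omega>) \<longlonglongrightarrow> X i \<omega>) \<longrightarrow>
        nn_cond_exp M N' (J X) \<omega> \<le> liminf (\<lambda>n. nn_cond_exp M N' (J (Y n)) \<omega>)"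
      using AE_space by eventually_elim (auto simp: A_def sp)
  next
    fix Y :: "nat \<Rightarrow> nat \<Rightarrow> 'w \<Rightarrow> 'a"
    assume Y: "\<forall>n. Y n \<in> tuples N' m"
    have [measurable]: "Y n i \<in> borel_measurable N'" if "i < m" for i n
      using Y that by (auto simp: tuples_def)
    define A where "A = {\<omega>\<in>space N'. \<exists>i\<in>{..<m}. filterlim (\<lambda>n. norm (Y n i \<omega>)) at_top sequentially}"
    have "{\<omega>\<in>space N'. filterlim (\<lambda>n. norm (Y n i \<omega>)) at_top sequentially} \<in> sets N'" if "i < m" for i
    proof -
      have "{\<omega>\<in>space N'. filterlim (\<lambda>n. norm (Y n i \<omega>)) at_top sequentially}
          = {\<omega>\<in>space N'. \<forall>k::nat. \<exists>l. \<forall>n\<ge>l. real k \<le> norm (Y n i \<omega>)}"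
        by (simp only: filterlim_at_top_iff_nat)
      also have "\<dots> \<in> sets N'"
        using that by measurable
      finally show ?thesis .
    qed
    then have A: "A \<in> sets N'" unfolding A_def by (intro sets.sets_Collect_finite_Ex) auto
    have "AE \<omega> in M. \<omega> \<in> A \<longrightarrow> nn_cond_exp M N' (\<lambda>_. \<top>) \<omega> \<le> liminf (\<lambda>n. nn_cond_exp M N' (J (Y n)) \<omega>)"
      using coercive_lsc_top[OF J, of Y] mem Y
      by (intro nn_cond_exp_le_liminf_on A) (auto simp: A_def meas elim!: eventually_mono)
    moreover have "AE \<omega> in M. \<top> = nn_cond_exp M N' (\<lambda>_. \<top>) \<omega>"
      by (rule nn_cond_exp_F_meas) auto
    ultimately show "AE \<omega> in M. (\<exists>i<m. filterlim (\<lambda>n. norm (Y n i \<omega>)) at_top sequentially) \<longrightarrow>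
           liminf (\<lambda>n. nn_cond_exp M N' (J (Y n)) \<omega>) = \<top>"
      using AE_space by eventually_elim (auto simp: A_def sp top_unique)
  qed simp
qed

subsection \<open>Random subsequences\<close>

lemma random_indices:
  fixes P :: "nat \<Rightarrow> nat \<Rightarrow> 'w \<Rightarrow> bool"
  assumes [measurable]: "\<And>k n. Measurable.pred N (P k n)"
  obtains \<tau> where "\<And>k. \<tau> k \<in> measurable N (count_space UNIV)" "\<And>k \<omega>. k \<le> \<tau> k \<omega>"
    "\<And>k \<omega>. \<exists>n\<ge>k. P k n \<omega> \<Longrightarrow> P k (\<tau> k \<omega>) \<omega>"
proof
  \<comment> \<open>The least index is a measurable choice. Where no index qualifies the implication
    is void and \<open>k\<close> itself is chosen, so the indices are defined on every path.\<close>
  define \<tau> where "\<tau> k \<omega> = (LEAST n. k \<le> n \<and> ((\<exists>m\<ge>k. P k m \<omega>) \<longrightarrow> P k n \<omega>))" for k \<omega>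
  show "\<tau> k \<in> measurable N (count_space UNIV)" for k
    unfolding \<tau>_def by measurable
  fix k \<omega>
  have "\<exists>n. k \<le> n \<and> ((\<exists>m\<ge>k. P k m \<omega>) \<longrightarrow> P k n \<omega>)" by auto
  from LeastI_ex[OF this]
  show "k \<le> \<tau> k \<omega>" "\<exists>n\<ge>k. P k n \<omega> \<Longrightarrow> P k (\<tau> k \<omega>) \<omega>"
    unfolding \<tau>_def by auto
qed

text \<open>Random indices are not made strictly increasing. The bound
  \<open>k \<le> \<sigma> k\<close> is enough to carry limits over, and it survives the composition
  of random indices.\<close>

lemma filterlim_ge_index: "(\<And>k. k \<le> \<sigma> k) \<Longrightarrow> filterlim \<sigma> sequentially sequentially" for \<sigma> :: "nat \<Rightarrow> nat"
  by (rule filterlim_at_top_mono[OF filterlim_ident]) auto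

text \<open>Boundedness keeps the lower limit finite, so that \<open>real_of_ereal\<close> returns
  it and not the default value 0.\<close>

lemma ex_close_to_liminf:
  fixes h :: "nat \<Rightarrow> real"
  assumes "bounded (range h)" and "0 < e"
  shows "\<exists>n\<ge>k. \<bar>h n - real_of_ereal (liminf (\<lambda>n. ereal (h n)))\<bar> < e"
proof -
  let ?l = "liminf (\<lambda>n. ereal (h n))"
  obtain C where C: "\<And>n. \<bar>h n\<bar> \<le> C" using assms(1) by (auto simp: bounded_iff)
  have "ereal (- C) \<le> ?l"
    by (rule Liminf_bounded) (use C in \<open>auto simp: abs_le_iff minus_le_iff\<close>)
  moreover have "?l \<le> limsup (\<lambda>n. ereal (h n))"
    by (rule Liminf_le_Limsup) simp
  moreover have "limsup (\<lambda>n. ereal (h n)) \<le> ereal C"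
    by (rule Limsup_bounded) (use C in \<open>auto simp: abs_le_iff\<close>)
  ultimately have "ereal (- C) \<le> ?l" "?l \<le> ereal C"
    by simp_all
  then obtain l where l: "?l = ereal l" by (cases ?l) simp_all
  obtain r where r: "strict_mono r" "((\<lambda>n. ereal (h n)) \<circ> r) \<longlonglongrightarrow> ?l"
    using liminf_subseq_lim by blast
  then have "(\<lambda>n. h (r n)) \<longlonglongrightarrow> l" by (simp add: l o_def)
  then obtain N where N: "\<And>n. n \<ge> N \<Longrightarrow> dist (h (r n)) l < e"
    using assms(2) by (auto simp: lim_sequentially)
  have "k \<le> r (max k N)" using seq_suble[OF r(1), of "max k N"] by simp
  then show ?thesis using N[of "max k N"] by (intro exI[of _ "r (max k N)"]) (simp add: l dist_real_def)
qed

text \<open>Coordinates are made convergent one at a time. The limit aimed at in a new coordinate is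
  the lower limit along the indices found so far, a cluster point that depends measurably on the
  path; the coordinates treated earlier keep converging under further reindexing.\<close>

lemma random_Bolzano_Weierstrass_inner:
  fixes \<zeta> :: "nat \<Rightarrow> 'w \<Rightarrow> 'a::euclidean_space"
  assumes [measurable]: "\<And>n. \<zeta> n \<in> borel_measurable N" and "finite B"
  shows "\<exists>\<sigma>. (\<forall>k. \<sigma> k \<in> measurable N (count_space UNIV)) \<and> (\<forall>k \<omega>. k \<le> \<sigma> k \<omega>) \<and>
    (\<forall>\<omega>. bounded (range (\<lambda>n. \<zeta> n \<omega>)) \<longrightarrow> (\<forall>b\<in>B. convergent (\<lambda>k. \<zeta> (\<sigma> k \<omega>) \<omega> \<bullet> b)))"
  using \<open>finite B\<close>
proof induction
  case empty
  show ?case by (intro exI[of _ "\<lambda>k \<omega>. k"]) auto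
next
  case (insert b B)
  then obtain \<sigma> where [measurable]: "\<And>k. \<sigma> k \<in> measurable N (count_space UNIV)"
    and ge: "\<And>k \<omega>. k \<le> \<sigma> k \<omega>"
    and conv: "\<And>\<omega> b. bounded (range (\<lambda>n. \<zeta> n \<omega>)) \<Longrightarrow> b \<in> B \<Longrightarrow> convergent (\<lambda>k. \<zeta> (\<sigma> k \<omega>) \<omega> \<bullet> b)"
    by blast
  define h where "h k \<omega> = \<zeta> (\<sigma> k \<omega>) \<omega> \<bullet> b" for k \<omega>
  define l where "l \<omega> = real_of_ereal (liminf (\<lambda>n. ereal (h n \<omega>)))" for \<omega>
  have [measurable]: "h k \<in> borel_measurable N" for k
  proof -
    have "(\<lambda>\<omega>. \<zeta> (\<sigma> k \<omega>) \<omega>) \<in> borel_measurable N"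
      by (rule measurable_compose_countable[where g = "\<sigma> k"]) auto
    then show ?thesis unfolding h_def by measurable
  qed
  have [measurable]: "l \<in> borel_measurable N" unfolding l_def by measurable
  obtain \<rho> where [measurable]: "\<And>k. \<rho> k \<in> measurable N (count_space UNIV)"
    and \<rho>: "\<And>k \<omega>. k \<le> \<rho> k \<omega>"
      "\<And>k \<omega>. \<exists>n\<ge>k. \<bar>h n \<omega> - l \<omega>\<bar> < 1 / Suc k \<Longrightarrow> \<bar>h (\<rho> k \<omega>) \<omega> - l \<omega>\<bar> < 1 / Suc k"
  proof (rule random_indices[where N = N and P = "\<lambda>k n \<omega>. \<bar>h n \<omega> - l \<omega>\<bar> < 1 / Suc k"])
    show "Measurable.pred N (\<lambda>\<omega>. \<bar>h n \<omega> - l \<omega>\<bar> < 1 / Suc k)" for k n by measurable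
  qed (rule that)
  show ?case
  proof (intro exI[of _ "\<lambda>k \<omega>. \<sigma> (\<rho> k \<omega>) \<omega>"] conjI allI impI ballI)
    show "(\<lambda>\<omega>. \<sigma> (\<rho> k \<omega>) \<omega>) \<in> measurable N (count_space UNIV)" for k
      by (rule measurable_compose_countable[where g = "\<rho> k"]) auto
    show "k \<le> \<sigma> (\<rho> k \<omega>) \<omega>" for k \<omega> using \<rho>(1) ge order_trans by blast
    fix \<omega> c assume bdd: "bounded (range (\<lambda>n. \<zeta> n \<omega>))" and c: "c \<in> insert b B"
    have "bounded (range (\<lambda>n. h n \<omega>))"
    proof -
      obtain C where "\<And>n. norm (\<zeta> n \<omega>) \<le> C" using bdd by (auto simp: bounded_iff)
      then have "\<bar>h n \<omega>\<bar> \<le> C * norm b" for n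
        unfolding h_def by (intro order_trans[OF Cauchy_Schwarz_ineq2] mult_right_mono) auto
      then show ?thesis by (auto simp: bounded_iff)
    qed
    then have close: "\<bar>h (\<rho> k \<omega>) \<omega> - l \<omega>\<bar> < 1 / Suc k" for k
      unfolding l_def by (intro \<rho>(2)[unfolded l_def] ex_close_to_liminf) auto
    show "convergent (\<lambda>k. \<zeta> (\<sigma> (\<rho> k \<omega>) \<omega>) \<omega> \<bullet> c)"
    proof (cases "c = b")
      case True
      have "(\<lambda>k. h (\<rho> k \<omega>) \<omega> - l \<omega>) \<longlonglongrightarrow> 0"
        by (rule LIMSEQ_norm_0) (use close in simp)
      then show ?thesis
        using True by (auto simp: h_def convergent_def LIM_zero_iff)
    next
      case False
      then obtain L where "(\<lambda>k. \<zeta> (\<sigma> k \<omega>) \<omega> \<bullet> c) \<longlonglongrightarrow> L"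
        using conv[OF bdd] c by (auto simp: convergent_def)
      from filterlim_compose[OF this filterlim_ge_index[of "\<lambda>k. \<rho> k \<omega>", OF \<rho>(1)]]
      show ?thesis by (auto simp: convergent_def)
    qed
  qed
qed

lemma random_Bolzano_Weierstrass:
  fixes \<zeta> :: "nat \<Rightarrow> 'w \<Rightarrow> 'a::euclidean_space"
  assumes [measurable]: "\<And>n. \<zeta> n \<in> borel_measurable N"
  obtains \<sigma> \<xi> where "\<And>k. \<sigma> k \<in> measurable N (count_space UNIV)" "\<And>k \<omega>. k \<le> \<sigma> k \<omega>"
    "\<xi> \<in> borel_measurable N"
    "\<And>\<omega>. bounded (range (\<lambda>n. \<zeta> n \<omega>)) \<Longrightarrow> (\<lambda>k. \<zeta> (\<sigma> k \<omega>) \<omega>) \<longlonglongrightarrow> \<xi> \<omega>"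
proof -
  obtain \<sigma> where [measurable]: "\<And>k. \<sigma> k \<in> measurable N (count_space UNIV)"
    and ge: "\<And>k \<omega>. k \<le> \<sigma> k \<omega>"
    and conv: "\<And>\<omega> b. bounded (range (\<lambda>n. \<zeta> n \<omega>)) \<Longrightarrow> b \<in> Basis \<Longrightarrow> convergent (\<lambda>k. \<zeta> (\<sigma> k \<omega>) \<omega> \<bullet> b)"
    using random_Bolzano_Weierstrass_inner[of \<zeta> N Basis, OF assms finite_Basis] by blast
  have [measurable]: "(\<lambda>\<omega>. \<zeta> (\<sigma> k \<omega>) \<omega>) \<in> borel_measurable N" for k
    by (rule measurable_compose_countable[where g = "\<sigma> k"]) auto
  show ?thesis
  proof (rule that)
    \<comment> \<open>On paths where the reindexed sequence diverges, \<open>lim\<close> returns a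
      default value; the limit is nevertheless measurable on the whole space.\<close>
    show "(\<lambda>\<omega>. lim (\<lambda>k. \<zeta> (\<sigma> k \<omega>) \<omega>)) \<in> borel_measurable N" by measurable
    fix \<omega> assume "bounded (range (\<lambda>n. \<zeta> n \<omega>))"
    then have "b \<in> Basis \<Longrightarrow> (\<lambda>k. \<zeta> (\<sigma> k \<omega>) \<omega> \<bullet> b) \<longlonglongrightarrow> lim (\<lambda>k. \<zeta> (\<sigma> k \<omega>) \<omega> \<bullet> b)" for b
      using conv by (simp add: convergent_LIMSEQ_iff)
    then have "(\<lambda>k. \<zeta> (\<sigma> k \<omega>) \<omega>) \<longlonglongrightarrow> (\<Sum>b\<in>Basis. lim (\<lambda>k. \<zeta> (\<sigma> k \<omega>) \<omega> \<bullet> b) *\<^sub>R b)"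
      by (subst tendsto_componentwise_iff) simp
    then show "(\<lambda>k. \<zeta> (\<sigma> k \<omega>) \<omega>) \<longlonglongrightarrow> lim (\<lambda>k. \<zeta> (\<sigma> k \<omega>) \<omega>)"
      by (simp add: limI)
  qed (use ge in auto)
qed

lemma tuples_random_index:
  assumes "\<And>n. Y n \<in> tuples N m" and [measurable]: "\<tau> \<in> measurable N (count_space UNIV)"
  shows "(\<lambda>i \<omega>. Y (\<tau> \<omega> :: nat) i \<omega>) \<in> tuples N m"
  unfolding tuples_def
proof safe
  fix i assume "i < m"
  then have [measurable]: "Y n i \<in> borel_measurable N" for n using assms(1) by (auto simp: tuples_def)
  show "(\<lambda>\<omega>. Y (\<tau> \<omega>) i \<omega>) \<in> borel_measurable N"
    by (rule measurable_compose_countable[where g = \<tau>]) auto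
qed

text \<open>Since \<open>J\<close> is not evaluated path by path, inserting a random index into a
  tuple is not obviously the same as selecting among the values \<open>J (Y n)\<close>. For each of
  the countably many \<open>n\<close>, locality compares the two tuples on the event where the index
  equals \<open>n\<close>.\<close>

lemma coercive_lsc_random_index:
  fixes \<tau> :: "nat \<Rightarrow> 'w \<Rightarrow> nat"
  assumes J: "coercive_lsc M N m J" and Y: "\<And>n. Y n \<in> tuples N m"
    and \<tau>: "\<And>k. \<tau> k \<in> measurable N (count_space UNIV)"
  shows "AE \<omega> in M. \<forall>k. J (\<lambda>i \<omega>. Y (\<tau> k \<omega>) i \<omega>) \<omega> = J (Y (\<tau> k \<omega>)) \<omega>"
proof -
  have "AE \<omega> in M. \<forall>k n. (\<forall>i<m. Y (\<tau> k \<omega>) i \<omega> = Y n i \<omega>) \<longrightarrow> J (\<lambda>i \<omega>. Y (\<tau> k \<omega>) i \<omega>) \<omega> = J (Y n) \<omega>"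
    unfolding AE_all_countable
    by (intro allI coercive_lsc_local[OF J tuples_random_index[where Y = Y, OF Y \<tau>] Y])
  then show ?thesis
  proof eventually_elim
    case (elim \<omega>)
    show ?case using elim by simp
  qed
qed

subsection \<open>Dynamic programming\<close>

lemma ex_le_liminf_add:
  fixes f :: "nat \<Rightarrow> ennreal"
  assumes "0 < e"
  shows "\<exists>n\<ge>k. f n \<le> liminf f + ennreal e"
proof (cases "liminf f = \<top>")
  case True
  then show ?thesis by (intro exI[of _ k]) simp
next
  case False
  show ?thesis
  proof (rule ccontr)
    assume "\<not> ?thesis"
    then have "\<forall>n\<ge>k. liminf f + ennreal e \<le> f n"
      by (meson less_imp_le not_le)
    then have "liminf f + ennreal e \<le> liminf f"
      by (intro Liminf_bounded) (auto simp: eventually_sequentially)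
    then show False
      using False assms by (simp add: ennreal_add_left_cancel_le[of "liminf f" _ 0, simplified])
  qed
qed

lemma filterlim_norm_at_top_if_ge_index:
  fixes x :: "nat \<Rightarrow> 'a::real_normed_vector"
  assumes "\<And>k. real k \<le> norm (x k)"
  shows "filterlim (\<lambda>k. norm (x k)) at_top sequentially"
  by (rule filterlim_at_top_mono[OF filterlim_real_sequentially]) (use assms in auto)

lemma unbounded_ex_norm_ge:
  fixes x :: "nat \<Rightarrow> 'a::real_normed_vector"
  assumes "\<not> bounded (range x)"
  shows "\<exists>n\<ge>k. real k \<le> norm (x n)"
proof (rule ccontr)
  assume "\<not> ?thesis"
  then have "Bseq (\<lambda>n. x (n + k))"
    by (intro BseqI'[of _ "real k"]) (auto simp: not_le intro: less_imp_le)
  then show False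
    using assms Bseq_offset Bseq_eq_bounded by blast
qed

text \<open>The last components converge only along subsequences that depend on \<open>\<omega>\<close>. Choosing their indices
  \<open>N\<close>-measurably keeps the reindexed tuples in the domain of \<open>J\<close>, and locality evaluates \<open>J\<close> there.\<close>

lemma coercive_lsc_closure:
  fixes J :: "(nat \<Rightarrow> 'w \<Rightarrow> 'a::euclidean_space) \<Rightarrow> 'w \<Rightarrow> ennreal"
  assumes J: "coercive_lsc M N (Suc m) J"
    and Y: "\<And>n. Y n \<in> tuples N (Suc m)" and X: "X \<in> tuples N m"
  shows "\<exists>\<xi>\<in>borel_measurable N. AE \<omega> in M.
    (\<forall>i<m. (\<lambda>n. Y n i \<omega>) \<longlonglongrightarrow> X i \<omega>) \<longrightarrow> J (X(m := \<xi>)) \<omega> \<le> liminf (\<lambda>n. J (Y n) \<omega>)"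
proof -
  define f where "f n = J (Y n)" for n
  define l where "l \<omega> = liminf (\<lambda>n. f n \<omega>)" for \<omega>
  have [measurable]: "f n \<in> borel_measurable N" for n
    unfolding f_def by (rule coercive_lsc_measurable[OF J Y])
  have [measurable]: "l \<in> borel_measurable N" unfolding l_def by measurable
  \<comment> \<open>At these indices the loss exceeds its lower limit by at most 1/(k+1); the bound
    is void where the lower limit is infinite.\<close>
  obtain \<tau> where \<tau>[measurable]: "\<And>k. \<tau> k \<in> measurable N (count_space UNIV)"
    and \<tau>_ge: "\<And>k \<omega>. k \<le> \<tau> k \<omega>"
    and "\<And>k \<omega>. \<exists>n\<ge>k. f n \<omega> \<le> l \<omega> + ennreal (1 / Suc k) \<Longrightarrow>
      f (\<tau> k \<omega>) \<omega> \<le> l \<omega> + ennreal (1 / Suc k)"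
  proof (rule random_indices[where N = N and P = "\<lambda>k n \<omega>. f n \<omega> \<le> l \<omega> + ennreal (1 / Suc k)"])
    show "Measurable.pred N (\<lambda>\<omega>. f n \<omega> \<le> l \<omega> + ennreal (1 / Suc k))" for k n by measurable
  qed (rule that)
  then have f_\<tau>: "f (\<tau> k \<omega>) \<omega> \<le> l \<omega> + ennreal (1 / Suc k)" for k \<omega>
    unfolding l_def using ex_le_liminf_add[of "1 / Suc k" k "\<lambda>n. f n \<omega>"] by simp
  define U where "U k = (\<lambda>i \<omega>. Y (\<tau> k \<omega>) i \<omega>)" for k
  have U: "U k \<in> tuples N (Suc m)" for k
    unfolding U_def by (rule tuples_random_index[OF Y \<tau>])
  then have U_m[measurable]: "U k m \<in> borel_measurable N" for k
    by (auto simp: tuples_def)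
  have J_U: "AE \<omega> in M. \<forall>k. J (U k) \<omega> = f (\<tau> k \<omega>) \<omega>"
    unfolding U_def f_def by (rule coercive_lsc_random_index[OF J Y \<tau>])

  \<comment> \<open>These indices serve a contradiction only. Where the last entries are unbounded
    they drive them to infinity, so coercivity makes the loss tend to infinity, although along
    \<open>U\<close> it stays below \<open>l \<omega> + 1\<close>.\<close>
  obtain \<rho> where \<rho>: "\<And>k. \<rho> k \<in> measurable N (count_space UNIV)"
    and \<rho>_ge: "\<And>k \<omega>. k \<le> \<rho> k \<omega>"
    and \<rho>_norm: "\<And>k \<omega>. \<exists>n\<ge>k. real k \<le> norm (U n m \<omega>) \<Longrightarrow> real k \<le> norm (U (\<rho> k \<omega>) m \<omega>)"
  proof (rule random_indices[where N = N and P = "\<lambda>k n \<omega>. real k \<le> norm (U n m \<omega>)"])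
    show "Measurable.pred N (\<lambda>\<omega>. real k \<le> norm (U n m \<omega>))" for k n by measurable
  qed (rule that)
  define V where "V k = (\<lambda>i \<omega>. U (\<rho> k \<omega>) i \<omega>)" for k
  have V: "V k \<in> tuples N (Suc m)" for k
    unfolding V_def by (rule tuples_random_index[OF U \<rho>])
  have J_V: "AE \<omega> in M. \<forall>k. J (V k) \<omega> = J (U (\<rho> k \<omega>)) \<omega>"
    unfolding V_def by (rule coercive_lsc_random_index[OF J U \<rho>])
  have bdd: "AE \<omega> in M. l \<omega> \<noteq> \<top> \<longrightarrow> bounded (range (\<lambda>k. U k m \<omega>))"
    using coercive_lsc_top[where Y = V, OF J V] J_U J_V
  proof eventually_elim
    case (elim \<omega>)
    show ?case
    proof (intro impI, rule ccontr)
      assume fin: "l \<omega> \<noteq> \<top>" and unb: "\<not> bounded (range (\<lambda>k. U k m \<omega>))"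
      have "real k \<le> norm (V k m \<omega>)" for k
        unfolding V_def by (rule \<rho>_norm) (rule unbounded_ex_norm_ge[OF unb])
      then have "filterlim (\<lambda>k. norm (V k m \<omega>)) at_top sequentially"
        by (rule filterlim_norm_at_top_if_ge_index)
      then have "liminf (\<lambda>k. J (V k) \<omega>) = \<top>" using elim(1) by blast
      moreover have "J (V k) \<omega> \<le> l \<omega> + 1" for k
      proof -
        have "J (V k) \<omega> \<le> l \<omega> + ennreal (1 / Suc (\<rho> k \<omega>))"
          using elim(2,3) f_\<tau>[of "\<rho> k \<omega>" \<omega>] by simp
        also have "\<dots> \<le> l \<omega> + ennreal 1"
          by (intro add_left_mono ennreal_leI) simp
        finally show ?thesis by simp
      qed
      then have "liminf (\<lambda>k. J (V k) \<omega>) \<le> liminf (\<lambda>k. l \<omega> + 1)"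
        by (intro Liminf_mono always_eventually) auto
      ultimately show False
        using fin by (simp add: Liminf_const top_unique)
    qed
  qed

  obtain \<sigma> \<xi> where \<sigma>: "\<And>k. \<sigma> k \<in> measurable N (count_space UNIV)" and \<sigma>_ge: "\<And>k \<omega>. k \<le> \<sigma> k \<omega>"
    and \<xi>: "\<xi> \<in> borel_measurable N"
    and lim: "\<And>\<omega>. bounded (range (\<lambda>n. U n m \<omega>)) \<Longrightarrow> (\<lambda>k. U (\<sigma> k \<omega>) m \<omega>) \<longlonglongrightarrow> \<xi> \<omega>"
    using random_Bolzano_Weierstrass[where \<zeta> = "\<lambda>n. U n m" and N = N] U_m by blast
  define W where "W k = (\<lambda>i \<omega>. U (\<sigma> k \<omega>) i \<omega>)" for k
  have W: "W k \<in> tuples N (Suc m)" for k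
    unfolding W_def by (rule tuples_random_index[OF U \<sigma>])
  have J_W: "AE \<omega> in M. \<forall>k. J (W k) \<omega> = J (U (\<sigma> k \<omega>)) \<omega>"
    unfolding W_def by (rule coercive_lsc_random_index[OF J U \<sigma>])
  have X': "X(m := \<xi>) \<in> tuples N (Suc m)"
    using X \<xi> by (auto simp: tuples_def less_Suc_eq)
  show ?thesis
  proof (intro bexI[of _ \<xi>] \<xi>)
    show "AE \<omega> in M. (\<forall>i<m. (\<lambda>n. Y n i \<omega>) \<longlonglongrightarrow> X i \<omega>) \<longrightarrow>
        J (X(m := \<xi>)) \<omega> \<le> liminf (\<lambda>n. J (Y n) \<omega>)"
      using coercive_lsc_liminf[where Y = W, OF J W X'] bdd J_U J_W
    proof eventually_elim
      case (elim \<omega>)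
      show ?case
      proof (intro impI, cases "l \<omega> = \<top>")
        case True
        then show "J (X(m := \<xi>)) \<omega> \<le> liminf (\<lambda>n. J (Y n) \<omega>)" by (simp add: l_def f_def)
      next
        case False
        assume conv: "\<forall>i<m. (\<lambda>n. Y n i \<omega>) \<longlonglongrightarrow> X i \<omega>"
        have "(\<lambda>k. W k i \<omega>) \<longlonglongrightarrow> (X(m := \<xi>)) i \<omega>" if "i < Suc m" for i
        proof (cases "i = m")
          case True
          then show ?thesis using lim elim(2) False by (simp add: W_def)
        next
          case False
          then have "(\<lambda>n. Y n i \<omega>) \<longlonglongrightarrow> X i \<omega>" using that conv by simp
          moreover have "filterlim (\<lambda>k. \<tau> (\<sigma> k \<omega>) \<omega>) sequentially sequentially"
            by (rule filterlim_ge_index) (use \<tau>_ge \<sigma>_ge order_trans in blast)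
          ultimately show ?thesis
            using False by (auto simp: W_def U_def dest: filterlim_compose)
        qed
        then have "J (X(m := \<xi>)) \<omega> \<le> liminf (\<lambda>k. J (W k) \<omega>)" using elim(1) by blast
        also have "\<dots> \<le> liminf (\<lambda>k. l \<omega> + ennreal (1 / Suc k))"
        proof (intro Liminf_mono always_eventually allI)
          fix k
          have "J (W k) \<omega> \<le> l \<omega> + ennreal (1 / Suc (\<sigma> k \<omega>))"
            using elim(3,4) f_\<tau>[of "\<sigma> k \<omega>" \<omega>] by simp
          also have "\<dots> \<le> l \<omega> + ennreal (1 / Suc k)"
            using \<sigma>_ge[of k \<omega>] by (intro add_left_mono ennreal_leI) (simp add: frac_le)
          finally show "J (W k) \<omega> \<le> l \<omega> + ennreal (1 / Suc k)" .
        qed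
        also have "\<dots> = l \<omega>"
        proof (rule lim_imp_Liminf)
          have "(\<lambda>k. 1 / real (Suc k)) \<longlonglongrightarrow> 0" by (rule lim_1_over_n[THEN LIMSEQ_Suc])
          then have "(\<lambda>k. ennreal (1 / Suc k)) \<longlonglongrightarrow> ennreal 0"
            by (rule tendsto_ennrealI)
          then have "(\<lambda>k. l \<omega> + ennreal (1 / Suc k)) \<longlonglongrightarrow> l \<omega> + ennreal 0"
            by (intro tendsto_add tendsto_const)
          then show "(\<lambda>k. l \<omega> + ennreal (1 / Suc k)) \<longlonglongrightarrow> l \<omega>" by simp
        qed simp
        finally show "J (X(m := \<xi>)) \<omega> \<le> liminf (\<lambda>n. J (Y n) \<omega>)"
          by (simp add: l_def f_def)
      qed
    qed
  qed
qed

section \<open>Attainment of the minimum over the last entry\<close>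

lemma coercive_lsc_below_sequence:
  fixes J :: "(nat \<Rightarrow> 'w \<Rightarrow> 'a::euclidean_space) \<Rightarrow> 'w \<Rightarrow> ennreal"
  assumes J: "coercive_lsc M N (Suc m) J" and X: "X \<in> tuples N m"
    and \<eta>: "\<And>n :: nat. \<eta> n \<in> borel_measurable N"
  shows "\<exists>\<xi>\<in>borel_measurable N. AE \<omega> in M. \<forall>n. J (X(m := \<xi>)) \<omega> \<le> J (X(m := \<eta> n)) \<omega>"
proof -
  \<comment> \<open>every \<open>\<eta> n\<close> occurs infinitely often in this enumeration, so the lower limit below is at most the infimum\<close>
  define Y where "Y k = X(m := \<eta> (fst (prod_decode k)))" for k
  have "Y k \<in> tuples N (Suc m)" for k
    using X \<eta> by (auto simp: tuples_def less_Suc_eq Y_def)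
  from coercive_lsc_closure[where Y = Y, OF J this X] obtain \<xi> where \<xi>: "\<xi> \<in> borel_measurable N"
    and le: "AE \<omega> in M. J (X(m := \<xi>)) \<omega> \<le> liminf (\<lambda>k. J (Y k) \<omega>)"
    by (auto simp: Y_def)
  have "liminf (\<lambda>k. J (Y k) \<omega>) \<le> J (X(m := \<eta> n)) \<omega>" for n \<omega>
    unfolding liminf_SUP_INF
  proof (rule SUP_least)
    fix j
    show "(INF k\<in>{j..}. J (Y k) \<omega>) \<le> J (X(m := \<eta> n)) \<omega>"
      by (rule INF_lower2[of "prod_encode (n, j)"]) (simp_all add: Y_def le_prod_encode_2)
  qed
  then show ?thesis
    using le by (intro bexI[OF _ \<xi>]) (auto elim!: eventually_mono intro: order_trans)
qed

text \<open>An order-reversing map of [0,\<infinity>] into [0,1]: it replaces possibly infinite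
  losses by quantities whose integrals are finite and can be compared.\<close>

lemma ennreal_inverse_add_1_le_iff:
  "inverse (1 + a) \<le> inverse (1 + b) \<longleftrightarrow> b \<le> (a::ennreal)"
proof -
  have eq: "inverse (1 + ennreal r) = ennreal (inverse (1 + r))" if "0 \<le> r" for r
    using that by (subst inverse_ennreal[symmetric]) (simp_all flip: ennreal_1 ennreal_plus)
  show ?thesis
    by (cases a; cases b) (auto simp: eq top_unique ennreal_le_iff2)
qed

text \<open>This is the argument for an essential infimum. A sequence of competitors exhausts the
  supremum \<open>S\<close> of the integrals of \<open>g\<close>, and a single \<open>\<xi>\<close>
  that is at least as good as all of them attains it. A competitor better than \<open>\<xi>\<close>
  on a set of positive measure could be combined with \<open>\<xi>\<close> into one whose integral
  exceeds \<open>S\<close>.\<close>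

lemma coercive_lsc_attains_min:
  fixes J :: "(nat \<Rightarrow> 'w \<Rightarrow> 'a::euclidean_space) \<Rightarrow> 'w \<Rightarrow> ennreal"
  assumes "prob_space M" and N: "subalgebra M N"
    and J: "coercive_lsc M N (Suc m) J" and X: "X \<in> tuples N m"
  shows "\<exists>\<xi>\<in>borel_measurable N. \<forall>\<eta>\<in>borel_measurable N.
    AE \<omega> in M. J (X(m := \<xi>)) \<omega> \<le> J (X(m := \<eta>)) \<omega>"
proof -
  interpret prob_space M by fact
  define g where "g \<eta> \<omega> = inverse (1 + J (X(m := \<eta>)) \<omega>)" for \<eta> \<omega>
  have [measurable]: "g \<eta> \<in> borel_measurable M" if "\<eta> \<in> borel_measurable N" for \<eta>
  proof -
    have "X(m := \<eta>) \<in> tuples N (Suc m)"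
      using X that by (auto simp: tuples_def less_Suc_eq)
    then have [measurable]: "J (X(m := \<eta>)) \<in> borel_measurable M"
      by (intro measurable_from_subalg[OF N] coercive_lsc_measurable[OF J])
    show ?thesis unfolding g_def by measurable
  qed
  have g_le_iff: "g \<eta> \<omega> \<le> g \<eta>' \<omega> \<longleftrightarrow> J (X(m := \<eta>')) \<omega> \<le> J (X(m := \<eta>)) \<omega>" for \<eta> \<eta>' \<omega>
    by (simp add: g_def ennreal_inverse_add_1_le_iff)
  define S where "S = (SUP \<eta>\<in>borel_measurable N. \<integral>\<^sup>+ \<omega>. g \<eta> \<omega> \<partial>M)"
  have "(borel_measurable N :: ('w \<Rightarrow> 'a) set) \<noteq> {}" using borel_measurable_const by blast
  from ennreal_SUP_countable_SUP[OF this, of "\<lambda>\<eta>. \<integral>\<^sup>+ \<omega>. g \<eta> \<omega> \<partial>M"]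
  obtain s :: "nat \<Rightarrow> ennreal" where s: "range s \<subseteq> (\<lambda>\<eta>. \<integral>\<^sup>+ \<omega>. g \<eta> \<omega> \<partial>M) ` borel_measurable N" "S = (SUP n. s n)"
    unfolding S_def by blast
  then have "\<forall>n. \<exists>\<eta>\<in>borel_measurable N. s n = (\<integral>\<^sup>+ \<omega>. g \<eta> \<omega> \<partial>M)" by blast
  then obtain \<eta> :: "nat \<Rightarrow> 'w \<Rightarrow> 'a" where \<eta>: "\<And>n. \<eta> n \<in> borel_measurable N" "\<And>n. s n = (\<integral>\<^sup>+ \<omega>. g (\<eta> n) \<omega> \<partial>M)"
    by metis
  obtain \<xi> where \<xi>: "\<xi> \<in> borel_measurable N"
    and le: "AE \<omega> in M. \<forall>n. J (X(m := \<xi>)) \<omega> \<le> J (X(m := \<eta> n)) \<omega>"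
    using coercive_lsc_below_sequence[where \<eta> = \<eta>, OF J X \<eta>(1)] by blast
  have S: "S \<le> (\<integral>\<^sup>+ \<omega>. g \<xi> \<omega> \<partial>M)"
    unfolding s(2) \<eta>(2)
    by (intro SUP_least nn_integral_mono_AE) (use le in \<open>auto simp: g_le_iff elim!: eventually_mono\<close>)
  have fin: "(\<integral>\<^sup>+ \<omega>. g \<xi> \<omega> \<partial>M) \<noteq> \<infinity>"
  proof -
    have "(\<integral>\<^sup>+ \<omega>. g \<xi> \<omega> \<partial>M) \<le> (\<integral>\<^sup>+ \<omega>. 1 \<partial>M)"
      by (intro nn_integral_mono) (simp add: g_def ennreal_inverse_add_1_le_iff[of _ 0, simplified])
    then show ?thesis by (auto simp: emeasure_space_1 top_unique)
  qed
  show ?thesis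
  proof (intro bexI[OF _ \<xi>] ballI)
    fix \<eta> :: "'w \<Rightarrow> 'a" assume \<eta>: "\<eta> \<in> borel_measurable N"
    \<comment> \<open>The sequence \<xi>, \<eta>, \<eta>, ... yields one competitor that is at least
      as good as both, without pasting them on an event.\<close>
    have "(if n = 0 then \<xi> else \<eta>) \<in> borel_measurable N" for n :: nat
      using \<xi> \<eta> by simp
    from coercive_lsc_below_sequence[where \<eta> = "\<lambda>n. if n = 0 then \<xi> else \<eta>", OF J X this]
    obtain \<xi>' where \<xi>': "\<xi>' \<in> borel_measurable N"
      and le': "AE \<omega> in M. \<forall>n::nat. J (X(m := \<xi>')) \<omega> \<le> J (X(m := if n = 0 then \<xi> else \<eta>)) \<omega>"
      by blast
    have le_\<xi>: "AE \<omega> in M. g \<xi> \<omega> \<le> g \<xi>' \<omega>"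
      using le' by eventually_elim (auto simp: g_le_iff dest: spec[of _ 0])
    have "(\<integral>\<^sup>+ \<omega>. g \<xi>' \<omega> \<partial>M) \<le> S"
      unfolding S_def by (rule SUP_upper[OF \<xi>'])
    then have "\<not> (\<integral>\<^sup>+ \<omega>. g \<xi> \<omega> \<partial>M) < (\<integral>\<^sup>+ \<omega>. g \<xi>' \<omega> \<partial>M)"
      using S by simp
    moreover have "g \<xi> \<in> borel_measurable M" "g \<xi>' \<in> borel_measurable M"
      using \<xi> \<xi>' by measurable
    ultimately have "AE \<omega> in M. g \<xi>' \<omega> \<le> g \<xi> \<omega>"
      using nn_integral_less[OF _ _ fin le_\<xi>] by blast
    with le' show "AE \<omega> in M. J (X(m := \<xi>)) \<omega> \<le> J (X(m := \<eta>)) \<omega>"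
      by eventually_elim (auto simp: g_le_iff dest!: spec[of _ 1] intro: order_trans)
  qed
qed

text \<open>The minimiser \<open>\<xi> X\<close> need not depend continuously on \<open>X\<close>.
  Closure provides some last entry whose loss is below the lower limit, and minimality passes the
  bound on to \<open>\<xi> X\<close>. Coercivity is inherited because a diverging entry of the short
  tuple is also an entry of the extended one.\<close>

lemma coercive_lsc_partial_min:
  fixes J :: "(nat \<Rightarrow> 'w \<Rightarrow> 'a::euclidean_space) \<Rightarrow> 'w \<Rightarrow> ennreal"
  assumes J: "coercive_lsc M N (Suc m) J"
    and \<xi>: "\<And>X. X \<in> tuples N m \<Longrightarrow> \<xi> X \<in> borel_measurable N"
    and min: "\<And>X \<eta>. X \<in> tuples N m \<Longrightarrow> \<eta> \<in> borel_measurable N \<Longrightarrow>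
      AE \<omega> in M. J (X(m := \<xi> X)) \<omega> \<le> J (X(m := \<eta>)) \<omega>"
  shows "coercive_lsc M N m (\<lambda>X. J (X(m := \<xi> X)))"
proof -
  have mem: "X(m := \<xi> X) \<in> tuples N (Suc m)" if "X \<in> tuples N m" for X
    using that \<xi>[OF that] by (auto simp: tuples_def less_Suc_eq)
  show ?thesis
    unfolding coercive_lsc_def
  proof (intro conjI ballI allI impI)
    show "J (X(m := \<xi> X)) \<in> borel_measurable N" if "X \<in> tuples N m" for X
      by (rule coercive_lsc_measurable[OF J mem[OF that]])
  next
    fix Y :: "nat \<Rightarrow> nat \<Rightarrow> 'w \<Rightarrow> 'a" and X :: "nat \<Rightarrow> 'w \<Rightarrow> 'a"
    assume Y: "\<forall>n. Y n \<in> tuples N m" and X: "X \<in> tuples N m"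
    then have Y': "(Y n)(m := \<xi> (Y n)) \<in> tuples N (Suc m)" for n
      by (intro mem) blast
    have "\<exists>\<eta>\<in>borel_measurable N. AE \<omega> in M.
        (\<forall>i<m. (\<lambda>n. ((Y n)(m := \<xi> (Y n))) i \<omega>) \<longlonglongrightarrow> X i \<omega>) \<longrightarrow>
        J (X(m := \<eta>)) \<omega> \<le> liminf (\<lambda>n. J ((Y n)(m := \<xi> (Y n))) \<omega>)"
      by (rule coercive_lsc_closure[OF J Y' X])
    then obtain \<eta> where \<eta>: "\<eta> \<in> borel_measurable N"
      and le: "AE \<omega> in M. (\<forall>i<m. (\<lambda>n. ((Y n)(m := \<xi> (Y n))) i \<omega>) \<longlonglongrightarrow> X i \<omega>) \<longrightarrow>
        J (X(m := \<eta>)) \<omega> \<le> liminf (\<lambda>n. J ((Y n)(m := \<xi> (Y n))) \<omega>)"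
      by blast
    show "AE \<omega> in M. (\<forall>i<m. (\<lambda>n. Y n i \<omega>) \<longlonglongrightarrow> X i \<omega>) \<longrightarrow>
        J (X(m := \<xi> X)) \<omega> \<le> liminf (\<lambda>n. J ((Y n)(m := \<xi> (Y n))) \<omega>)"
      using le min[OF X \<eta>] by eventually_elim (auto intro: order_trans)
  next
    fix Y :: "nat \<Rightarrow> nat \<Rightarrow> 'w \<Rightarrow> 'a"
    assume Y: "\<forall>n. Y n \<in> tuples N m"
    then have Y': "(Y n)(m := \<xi> (Y n)) \<in> tuples N (Suc m)" for n
      by (intro mem) blast
    have "AE \<omega> in M. (\<exists>i<Suc m. filterlim (\<lambda>n. norm (((Y n)(m := \<xi> (Y n))) i \<omega>)) at_top sequentially) \<longrightarrow>
        liminf (\<lambda>n. J ((Y n)(m := \<xi> (Y n))) \<omega>) = \<top>"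
      by (rule coercive_lsc_top[OF J Y'])
    then show "AE \<omega> in M. (\<exists>i<m. filterlim (\<lambda>n. norm (Y n i \<omega>)) at_top sequentially) \<longrightarrow>
        liminf (\<lambda>n. J ((Y n)(m := \<xi> (Y n))) \<omega>) = \<top>"
    proof eventually_elim
      case (elim \<omega>)
      show ?case
      proof
        assume "\<exists>i<m. filterlim (\<lambda>n. norm (Y n i \<omega>)) at_top sequentially"
        then obtain i where "i < m" "filterlim (\<lambda>n. norm (Y n i \<omega>)) at_top sequentially" by blast
        then show "liminf (\<lambda>n. J ((Y n)(m := \<xi> (Y n))) \<omega>) = \<top>"
          by (intro elim[THEN mp] exI[of _ i]) simp
      qed
    qed
  qed
qed

text \<open>Backward induction on the last decision. Conditioning on \<open>F m\<close> leaves the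
  integral unchanged and reduces the information to what is known when entry \<open>m\<close> is
  chosen, so that this entry can be minimised out. The remaining functional is coercive for
  \<open>F m\<close>, which becomes the new \<open>N\<close>; this is why \<open>N\<close> varies in
  the induction.\<close>

lemma adapted_minimizer:
  fixes J :: "(nat \<Rightarrow> 'w \<Rightarrow> 'a::euclidean_space) \<Rightarrow> 'w \<Rightarrow> ennreal"
  assumes "prob_space M" and "subalgebra M N"
    and "\<And>i. i < m \<Longrightarrow> subalgebra N (F i)" and "\<And>i j. i \<le> j \<Longrightarrow> j < m \<Longrightarrow> subalgebra (F j) (F i)"
    and "coercive_lsc M N m J"
  shows "\<exists>X. (\<forall>i<m. X i \<in> borel_measurable (F i)) \<and>
    (\<forall>Y. (\<forall>i<m. Y i \<in> borel_measurable (F i)) \<longrightarrow> (\<integral>\<^sup>+ \<omega>. J X \<omega> \<partial>M) \<le> (\<integral>\<^sup>+ \<omega>. J Y \<omega> \<partial>M))"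
  using assms(2-)
proof (induction m arbitrary: N J)
  case 0
  \<comment> \<open>With no entries left any two tuples agree vacuously, so locality makes the loss
    the same for all of them up to null sets.\<close>
  have "(\<integral>\<^sup>+ \<omega>. J X \<omega> \<partial>M) = (\<integral>\<^sup>+ \<omega>. J Y \<omega> \<partial>M)" for X Y
    using coercive_lsc_local[OF 0(4), of X Y] by (intro nn_integral_cong_AE) (simp add: tuples_def)
  then show ?case by (metis less_nat_zero_code order_refl)
next
  case (Suc m)
  interpret prob_space M by fact
  have Fm: "subalgebra M (F m)"
    using Suc.prems(1) Suc.prems(2)[of m] by (auto simp: subalgebra_def)
  interpret finite_measure_subalgebra M "F m"
    by unfold_locales (rule Fm)
  define K where "K X = nn_cond_exp M (F m) (J X)" for X
  have K: "coercive_lsc M (F m) (Suc m) K"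
    unfolding K_def
    by (rule coercive_lsc_cond_exp[OF _ Suc.prems(1) Suc.prems(2) Suc.prems(4)]) (auto intro: sigma_finite_subalgebra_axioms)
  have "\<forall>X\<in>tuples (F m) m. \<exists>\<xi>. \<xi> \<in> borel_measurable (F m) \<and>
      (\<forall>\<eta>\<in>borel_measurable (F m). AE \<omega> in M. K (X(m := \<xi>)) \<omega> \<le> K (X(m := \<eta>)) \<omega>)"
    using coercive_lsc_attains_min[OF \<open>prob_space M\<close> Fm K] by blast
  from bchoice[OF this] obtain \<xi> where \<xi>: "\<And>X. X \<in> tuples (F m) m \<Longrightarrow> \<xi> X \<in> borel_measurable (F m)"
    and min: "\<And>X \<eta>. X \<in> tuples (F m) m \<Longrightarrow> \<eta> \<in> borel_measurable (F m) \<Longrightarrow>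
      AE \<omega> in M. K (X(m := \<xi> X)) \<omega> \<le> K (X(m := \<eta>)) \<omega>"
    by blast
  have lsc: "coercive_lsc M (F m) m (\<lambda>X. K (X(m := \<xi> X)))"
    by (rule coercive_lsc_partial_min[OF K \<xi> min])
  have sub: "subalgebra (F m) (F i)" if "i < m" for i
    using that by (intro Suc.prems(3)) auto
  have sub': "subalgebra (F j) (F i)" if "i \<le> j" "j < m" for i j
    using that by (intro Suc.prems(3)) auto
  have "\<exists>X. (\<forall>i<m. X i \<in> borel_measurable (F i)) \<and>
      (\<forall>Y. (\<forall>i<m. Y i \<in> borel_measurable (F i)) \<longrightarrow>
      (\<integral>\<^sup>+ \<omega>. K (X(m := \<xi> X)) \<omega> \<partial>M) \<le> (\<integral>\<^sup>+ \<omega>. K (Y(m := \<xi> Y)) \<omega> \<partial>M))"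
    by (rule Suc.IH[OF Fm sub sub' lsc])
  then obtain X where "\<forall>i<m. X i \<in> borel_measurable (F i)"
    and "\<forall>Y. (\<forall>i<m. Y i \<in> borel_measurable (F i)) \<longrightarrow>
      (\<integral>\<^sup>+ \<omega>. K (X(m := \<xi> X)) \<omega> \<partial>M) \<le> (\<integral>\<^sup>+ \<omega>. K (Y(m := \<xi> Y)) \<omega> \<partial>M)"
    by blast
  then have X: "\<And>i. i < m \<Longrightarrow> X i \<in> borel_measurable (F i)"
    and opt: "\<And>Y. (\<And>i. i < m \<Longrightarrow> Y i \<in> borel_measurable (F i)) \<Longrightarrow>
      (\<integral>\<^sup>+ \<omega>. K (X(m := \<xi> X)) \<omega> \<partial>M) \<le> (\<integral>\<^sup>+ \<omega>. K (Y(m := \<xi> Y)) \<omega> \<partial>M)"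
    by blast+
  have tup: "Y \<in> tuples (F m) m" if "\<And>i. i < m \<Longrightarrow> Y i \<in> borel_measurable (F i)" for Y :: "nat \<Rightarrow> 'w \<Rightarrow> 'a"
    using measurable_from_subalg[OF sub that] by (simp add: tuples_def)
  have int_K: "(\<integral>\<^sup>+ \<omega>. K Y \<omega> \<partial>M) = (\<integral>\<^sup>+ \<omega>. J Y \<omega> \<partial>M)" if "Y \<in> tuples (F m) (Suc m)" for Y
  proof -
    have "J Y \<in> borel_measurable M"
      by (rule measurable_from_subalg[OF Suc.prems(1)], rule coercive_lsc_measurable[OF Suc.prems(4)],
          rule tuples_mono[OF _ that]) (simp add: Suc.prems(2))
    then show ?thesis unfolding K_def by (rule nn_integral_nn_cond_exp)
  qed
  show ?case
  proof (intro exI[of _ "X(m := \<xi> X)"] conjI allI impI)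
    show "(X(m := \<xi> X)) i \<in> borel_measurable (F i)" if "i < Suc m" for i
      using that X \<xi>[OF tup[OF X]] by (auto simp: less_Suc_eq)
    fix Y :: "nat \<Rightarrow> 'w \<Rightarrow> 'a" assume Y: "\<forall>i<Suc m. Y i \<in> borel_measurable (F i)"
    have X': "X(m := \<xi> X) \<in> tuples (F m) (Suc m)"
      using tup[OF X] \<xi>[OF tup[OF X]] by (auto simp: tuples_def less_Suc_eq)
    have Y': "Y \<in> tuples (F m) m" "Y \<in> tuples (F m) (Suc m)"
      using tup[of Y] Y by (auto simp: tuples_def less_Suc_eq)
    have "(\<integral>\<^sup>+ \<omega>. J (X(m := \<xi> X)) \<omega> \<partial>M) = (\<integral>\<^sup>+ \<omega>. K (X(m := \<xi> X)) \<omega> \<partial>M)"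
      by (rule int_K[OF X', symmetric])
    also have "\<dots> \<le> (\<integral>\<^sup>+ \<omega>. K (Y(m := \<xi> Y)) \<omega> \<partial>M)"
      using Y by (intro opt) auto
    also have "\<dots> \<le> (\<integral>\<^sup>+ \<omega>. K (Y(m := Y m)) \<omega> \<partial>M)"
      using Y by (intro nn_integral_mono_AE min Y') auto
    also have "\<dots> = (\<integral>\<^sup>+ \<omega>. J Y \<omega> \<partial>M)"
      using int_K[OF Y'(2)] by simp
    finally show "(\<integral>\<^sup>+ \<omega>. J (X(m := \<xi> X)) \<omega> \<partial>M) \<le> (\<integral>\<^sup>+ \<omega>. J Y \<omega> \<partial>M)" .
  qed
qed

subsection \<open>Coercivity of trading costs\<close>

lemma finite_family_convergent_subsequence:
  fixes x :: "nat \<Rightarrow> 'i \<Rightarrow> 'a::heine_borel"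
  assumes "finite I" and "\<And>i. i \<in> I \<Longrightarrow> bounded (range (\<lambda>n. x n i))"
  shows "\<exists>r d. strict_mono (r :: nat \<Rightarrow> nat) \<and> (\<forall>i\<in>I. (\<lambda>n. x (r n) i) \<longlonglongrightarrow> d i)"
  using assms
proof induction
  case empty
  show ?case by (auto intro!: exI[of _ id] strict_mono_id)
next
  case (insert j I)
  then obtain r d where r: "strict_mono r" and d: "\<And>i. i \<in> I \<Longrightarrow> (\<lambda>n. x (r n) i) \<longlonglongrightarrow> d i"
    by auto
  have "bounded (range (\<lambda>n. x (r n) j))"
    using insert.prems[of j] by (auto intro: bounded_subset)
  from bounded_imp_convergent_subsequence[OF this] obtain l s
    where s: "strict_mono s" and l: "(\<lambda>n. x (r (s n)) j) \<longlonglongrightarrow> l"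
    by (auto simp: o_def)
  have "(\<lambda>n. x (r (s n)) i) \<longlonglongrightarrow> d i" if "i \<in> I" for i
    using LIMSEQ_subseq_LIMSEQ[OF d[OF that] s] by (simp add: o_def)
  then show ?case
    using r s l insert.hyps by (intro exI[of _ "r \<circ> s"] exI[of _ "d(j := l)"]) (auto simp: strict_mono_def)
qed

text \<open>A value described by \<open>Lim\<close> says nothing about convergence; the slope
  conditions become estimates for large \<alpha> only once convergence is established.\<close>

lemma asymptotic_slope_tendsto:
  fixes g :: "'a::real_vector \<Rightarrow> real"
  assumes "convex_on UNIV g"
  shows "((\<lambda>\<alpha>. ereal (g (\<alpha> *\<^sub>R z) / \<alpha>)) \<longlongrightarrow> asymptotic_slope g z) at_top"
proof -
  define q where "q \<alpha> = (g (\<alpha> *\<^sub>R z) - g 0) / \<alpha>" for \<alpha>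
  have mono: "q \<alpha> \<le> q \<beta>" if "0 < \<alpha>" "\<alpha> \<le> \<beta>" for \<alpha> \<beta>
  proof -
    have "g ((1 - \<alpha> / \<beta>) *\<^sub>R 0 + (\<alpha> / \<beta>) *\<^sub>R (\<beta> *\<^sub>R z)) \<le> (1 - \<alpha> / \<beta>) * g 0 + (\<alpha> / \<beta>) * g (\<beta> *\<^sub>R z)"
      by (rule convex_onD[OF assms]) (use that in auto)
    then have "g (\<alpha> *\<^sub>R z) - g 0 \<le> (\<alpha> / \<beta>) * (g (\<beta> *\<^sub>R z) - g 0)"
      using that by (simp add: algebra_simps)
    then show ?thesis
      using that by (simp add: q_def field_simps)
  qed
  define L where "L = (SUP \<alpha>\<in>{0<..}. ereal (q \<alpha>))"
  have "((\<lambda>\<alpha>. ereal (q \<alpha>)) \<longlongrightarrow> L) at_top"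
  proof (rule order_tendstoI)
    fix a assume "a < L"
    then obtain \<alpha>0 where "0 < \<alpha>0" "a < ereal (q \<alpha>0)"
      by (auto simp: L_def less_SUP_iff)
    then show "\<forall>\<^sub>F \<alpha> in at_top. a < ereal (q \<alpha>)"
      using mono by (auto simp: eventually_at_top_linorder intro!: exI[of _ \<alpha>0] elim!: less_le_trans)
  next
    fix a assume "L < a"
    have "ereal (q \<alpha>) \<le> L" if "0 < \<alpha>" for \<alpha>
      unfolding L_def using that by (intro SUP_upper) auto
    then show "\<forall>\<^sub>F \<alpha> in at_top. ereal (q \<alpha>) < a"
      using \<open>L < a\<close> by (intro eventually_mono[OF eventually_gt_at_top[of 0]]) (rule le_less_trans)
  qed
  moreover have "((\<lambda>\<alpha>. ereal (g 0 / \<alpha>)) \<longlongrightarrow> ereal 0) at_top"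
    by (intro tendsto_ereal tendsto_divide_0[OF tendsto_const] filterlim_at_top_imp_at_infinity filterlim_ident)
  ultimately have "((\<lambda>\<alpha>. ereal (q \<alpha>) + ereal (g 0 / \<alpha>)) \<longlongrightarrow> L + ereal 0) at_top"
    by (intro tendsto_add_ereal_general) auto
  then have "((\<lambda>\<alpha>. ereal (g (\<alpha> *\<^sub>R z) / \<alpha>)) \<longlongrightarrow> L) at_top"
    by (simp add: q_def flip: add_divide_distrib)
  moreover from this have "asymptotic_slope g z = L"
    unfolding asymptotic_slope_def by (intro tendsto_Lim) auto
  ultimately show ?thesis by simp
qed

lemma sum_nonpos_orthant_eq_0:
  fixes d :: "'i \<Rightarrow> real ^ 'n"
  assumes "finite I" and "\<And>i. i \<in> I \<Longrightarrow> d i \<in> nonpos_orthant" and "(\<Sum>i\<in>I. d i) = 0" and "i \<in> I"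
  shows "d i = 0"
proof -
  have "(\<Sum>i\<in>I. d i $ j) = 0" for j
    using arg_cong[OF assms(3), of "\<lambda>v. v $ j"] by simp
  moreover have "d i $ j \<le> 0" if "i \<in> I" for i j
    using assms(2)[OF that] by (simp add: nonpos_orthant_def)
  ultimately have "d i $ j = 0" for j
    using assms(1,4) sum_nonneg_eq_0_iff[of I "\<lambda>i. - (d i $ j)"] by (auto simp: sum_negf)
  then show ?thesis by (simp add: vec_eq_iff)
qed

text \<open>A normalised limit \<open>d\<close> of trades of bounded cost is a direction along which the convex total
  cost never exceeds its value at 0; the slope conditions then put every \<open>d t\<close> into the nonpositive
  orthant, and as the trades add up to 0, so do the \<open>d t\<close>.\<close>

lemma trading_cost_coercive:
  fixes g :: "nat \<Rightarrow> real ^ 'n \<Rightarrow> real" and Z :: "nat \<Rightarrow> real ^ 'n" and D :: "nat \<Rightarrow> nat \<Rightarrow> real ^ 'n"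
  assumes convex: "\<And>t. t \<le> T \<Longrightarrow> convex_on UNIV (g t)"
    and slope: "\<And>t z. t \<le> T \<Longrightarrow> ereal (- (Z t \<bullet> z)) \<le> asymptotic_slope (g t) z"
    and slope_strict: "\<And>t z. t \<le> T \<Longrightarrow> z \<notin> nonpos_orthant \<Longrightarrow> ereal (- (Z t \<bullet> z)) < asymptotic_slope (g t) z"
    and sum_0: "\<And>k. (\<Sum>t=0..T. D k t) = 0"
    and norm_D: "filterlim (\<lambda>k. \<Sum>t=0..T. norm (D k t)) at_top sequentially"
  shows "filterlim (\<lambda>k. \<Sum>t=0..T. D k t \<bullet> Z t + g t (D k t)) at_top sequentially"
proof (rule ccontr)
  define p where "p t z = z \<bullet> Z t + g t z" for t z
  have p_convex: "convex_on UNIV (p t)" if "t \<le> T" for t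
  proof -
    have "convex_on UNIV (\<lambda>z. z \<bullet> Z t)"
      by (intro convex_onI) (auto simp: inner_add_left)
    then show ?thesis
      unfolding p_def using convex[OF that] by (rule convex_on_add)
  qed
  assume "\<not> ?thesis"
  then obtain K where "\<not> (\<forall>\<^sub>F k in sequentially. K \<le> (\<Sum>t=0..T. p t (D k t)))"
    unfolding filterlim_at_top p_def by blast
  from not_eventually_sequentiallyD[OF this] obtain s :: "nat \<Rightarrow> nat" where s: "strict_mono s"
    and "\<forall>k. \<not> K \<le> (\<Sum>t=0..T. p t (D (s k) t))"
    by blast
  then have K: "(\<Sum>t=0..T. p t (D (s k) t)) < K" for k
    by (simp add: not_le)
  define R where "R k = (\<Sum>t=0..T. norm (D (s k) t))" for k
  have R: "filterlim R at_top sequentially"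
    unfolding R_def using filterlim_compose[OF norm_D filterlim_subseq[OF s]] .
  have R_nonneg: "0 \<le> R k" for k unfolding R_def by (intro sum_nonneg) auto
  \<comment> \<open>\<open>R k\<close> may vanish for small \<open>k\<close>. Division by zero then
    makes \<open>y k t\<close> zero, so the bound by 1 holds for every \<open>k\<close>.\<close>
  define y where "y k t = (1 / R k) *\<^sub>R D (s k) t" for k t
  have "bounded (range (\<lambda>k. y k t))" if "t \<in> {0..T}" for t
  proof -
    have "norm (D (s k) t) \<le> R k" for k
      unfolding R_def using that by (intro member_le_sum) auto
    then have "norm (y k t) \<le> 1" for k
      using R_nonneg[of k] by (auto simp: y_def divide_le_eq_1)
    then show ?thesis by (auto simp: bounded_iff)
  qed
  from finite_family_convergent_subsequence[of "{0..T}" y, OF _ this] obtain r :: "nat \<Rightarrow> nat" and d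
    where r: "strict_mono r" and d: "\<And>t. t \<in> {0..T} \<Longrightarrow> (\<lambda>n. y (r n) t) \<longlonglongrightarrow> d t"
    by blast
  have Rr: "filterlim (\<lambda>n. R (r n)) at_top sequentially"
    using filterlim_compose[OF R filterlim_subseq[OF r]] .
  have d_sum: "(\<Sum>t=0..T. d t) = 0"
  proof (rule LIMSEQ_unique)
    show "(\<lambda>n. \<Sum>t=0..T. y (r n) t) \<longlonglongrightarrow> (\<Sum>t=0..T. d t)" by (intro tendsto_sum d)
    show "(\<lambda>n. \<Sum>t=0..T. y (r n) t) \<longlonglongrightarrow> 0"
      by (simp add: y_def sum_0 flip: scaleR_sum_right)
  qed
  have d_norm: "(\<Sum>t=0..T. norm (d t)) = 1"
  proof (rule LIMSEQ_unique)
    show "(\<lambda>n. \<Sum>t=0..T. norm (y (r n) t)) \<longlonglongrightarrow> (\<Sum>t=0..T. norm (d t))" by (intro tendsto_sum tendsto_norm d)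
    have "\<forall>\<^sub>F n in sequentially. 0 < R (r n)" using Rr by (simp add: filterlim_at_top_dense)
    then have "\<forall>\<^sub>F n in sequentially. (\<Sum>t=0..T. norm (y (r n) t)) = 1"
      by eventually_elim (simp add: y_def R_def flip: sum_divide_distrib)
    then show "(\<lambda>n. \<Sum>t=0..T. norm (y (r n) t)) \<longlonglongrightarrow> 1" by (rule tendsto_eventually)
  qed
  define P0 where "P0 = (\<Sum>t=0..T. p t 0)"
  \<comment> \<open>For large \<open>n\<close> the point \<alpha> y is a convex combination of 0 and
    the actual trade, with weight \<alpha>/R on the trade. The weight tends to 0, so the cost bound
    \<open>K\<close> drops out in the limit, and continuity of the convex costs carries the estimate
    over to \<open>d\<close>.\<close>
  have ray: "(\<Sum>t=0..T. p t (\<alpha> *\<^sub>R d t)) \<le> P0" if "0 < \<alpha>" for \<alpha>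
  proof (rule tendsto_le)
    have "isCont (p t) (\<alpha> *\<^sub>R d t)" if "t \<in> {0..T}" for t
      using convex_on_continuous[OF open_UNIV p_convex[of t]] that
      by (simp add: continuous_on_eq_continuous_at)
    then show "(\<lambda>n. \<Sum>t=0..T. p t (\<alpha> *\<^sub>R y (r n) t)) \<longlonglongrightarrow> (\<Sum>t=0..T. p t (\<alpha> *\<^sub>R d t))"
      using d by (intro tendsto_sum isCont_tendsto_compose[where g = "p _"] tendsto_scaleR tendsto_const) auto
    have "(\<lambda>n. \<alpha> / R (r n)) \<longlonglongrightarrow> 0"
      using Rr by (intro tendsto_divide_0[OF tendsto_const] filterlim_at_top_imp_at_infinity)
    then have "(\<lambda>n. (1 - \<alpha> / R (r n)) * P0 + \<alpha> / R (r n) * K) \<longlonglongrightarrow> (1 - 0) * P0 + 0 * K"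
      by (intro tendsto_intros)
    then show "(\<lambda>n. (1 - \<alpha> / R (r n)) * P0 + \<alpha> / R (r n) * K) \<longlonglongrightarrow> P0" by simp
    have "\<forall>\<^sub>F n in sequentially. \<alpha> \<le> R (r n)" using Rr by (simp add: filterlim_at_top)
    then show "\<forall>\<^sub>F n in sequentially. (\<Sum>t=0..T. p t (\<alpha> *\<^sub>R y (r n) t)) \<le> (1 - \<alpha> / R (r n)) * P0 + \<alpha> / R (r n) * K"
    proof eventually_elim
      case (elim n)
      let ?a = "\<alpha> / R (r n)"
      have a: "0 \<le> ?a" "?a \<le> 1" using elim that by auto
      have "(\<Sum>t=0..T. p t (\<alpha> *\<^sub>R y (r n) t)) \<le> (\<Sum>t=0..T. (1 - ?a) * p t 0 + ?a * p t (D (s (r n)) t))"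
      proof (rule sum_mono)
        fix t assume "t \<in> {0..T}"
        then have "p t ((1 - ?a) *\<^sub>R 0 + ?a *\<^sub>R D (s (r n)) t) \<le> (1 - ?a) * p t 0 + ?a * p t (D (s (r n)) t)"
          using a by (intro convex_onD[OF p_convex]) auto
        then show "p t (\<alpha> *\<^sub>R y (r n) t) \<le> (1 - ?a) * p t 0 + ?a * p t (D (s (r n)) t)"
          by (simp add: y_def)
      qed
      also have "\<dots> = (1 - ?a) * P0 + ?a * (\<Sum>t=0..T. p t (D (s (r n)) t))"
        by (simp add: P0_def sum.distrib sum_distrib_left)
      also have "\<dots> \<le> (1 - ?a) * P0 + ?a * K"
        using K[of "r n"] a by (intro add_left_mono mult_left_mono) auto
      finally show ?case .
    qed
  qed simp
  obtain t0 where t0: "t0 \<le> T" "d t0 \<notin> nonpos_orthant"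
  proof -
    have "\<not> (\<forall>t\<in>{0..T}. d t \<in> nonpos_orthant)"
    proof
      assume "\<forall>t\<in>{0..T}. d t \<in> nonpos_orthant"
      then have "d t = 0" if "t \<in> {0..T}" for t
        using that d_sum by (intro sum_nonpos_orthant_eq_0[of "{0..T}" d]) auto
      then show False using d_norm by simp
    qed
    then show ?thesis using that by auto
  qed
  have p_gt: "\<forall>\<^sub>F \<alpha> in at_top. c + Z t \<bullet> d t < p t (\<alpha> *\<^sub>R d t) / \<alpha>"
    if "t \<le> T" "ereal c < asymptotic_slope (g t) (d t)" for t c
    using order_tendstoD(1)[OF asymptotic_slope_tendsto[OF convex[OF that(1)]] that(2)] eventually_gt_at_top[of "0::real"]
    by eventually_elim (simp add: p_def field_simps inner_commute)
  obtain c where c: "ereal (- (Z t0 \<bullet> d t0)) < ereal c" "ereal c < asymptotic_slope (g t0) (d t0)"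
    using ereal_dense2[OF slope_strict[OF t0]] by blast
  define e where "e = c + Z t0 \<bullet> d t0"
  have e: "0 < e" using c(1) by (simp add: e_def)
  \<comment> \<open>At \<open>t0\<close> the cost grows at a rate above \<open>e\<close>; at the
    other dates the weak slope condition only gives a rate above -\<epsilon>. Spreading
    \<open>e / 2\<close> over the \<open>T + 1\<close> dates leaves a total rate of at least
    \<open>e / 2\<close>, whereas \<open>ray\<close> bounds the total cost by the constant
    \<open>P0\<close>.\<close>
  define \<epsilon> where "\<epsilon> = e / 2 / (real T + 1)"
  have \<epsilon>: "0 < \<epsilon>" using e by (simp add: \<epsilon>_def)
  have "\<forall>\<^sub>F \<alpha> in at_top. (if t = t0 then e else 0) - \<epsilon> < p t (\<alpha> *\<^sub>R d t) / \<alpha>" if "t \<in> {0..T}" for t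
  proof (cases "t = t0")
    case True
    then show ?thesis
      using p_gt[OF t0(1) c(2)] \<epsilon> by (auto simp: e_def elim!: eventually_mono)
  next
    case False
    have "ereal (- (Z t \<bullet> d t) - \<epsilon>) < ereal (- (Z t \<bullet> d t))" using \<epsilon> by simp
    also have "\<dots> \<le> asymptotic_slope (g t) (d t)" using that by (intro slope) simp
    finally show ?thesis
      using p_gt[of t "- (Z t \<bullet> d t) - \<epsilon>"] that False by simp
  qed
  then have "\<forall>\<^sub>F \<alpha> in at_top. \<forall>t\<in>{0..T}. (if t = t0 then e else 0) - \<epsilon> < p t (\<alpha> *\<^sub>R d t) / \<alpha>"
    by (simp add: eventually_ball_finite_distrib)
  moreover have "((\<lambda>\<alpha>. P0 / \<alpha>) \<longlongrightarrow> 0) at_top"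
    by (intro tendsto_divide_0[OF tendsto_const] filterlim_at_top_imp_at_infinity filterlim_ident)
  then have "\<forall>\<^sub>F \<alpha> in at_top. P0 / \<alpha> < e / 2"
    using e by (intro order_tendstoD(2)) auto
  ultimately have "\<forall>\<^sub>F \<alpha> in at_top. (\<forall>t\<in>{0..T}. (if t = t0 then e else 0) - \<epsilon> < p t (\<alpha> *\<^sub>R d t) / \<alpha>) \<and>
      P0 / \<alpha> < e / 2 \<and> 0 < \<alpha>"
    by (intro eventually_conj eventually_gt_at_top)
  then obtain \<alpha> where \<alpha>: "\<And>t. t \<in> {0..T} \<Longrightarrow> (if t = t0 then e else 0) - \<epsilon> < p t (\<alpha> *\<^sub>R d t) / \<alpha>"
    "P0 / \<alpha> < e / 2" "0 < \<alpha>"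
    using eventually_happens' trivial_limit_at_top_linorder by blast
  have "real T + 1 \<noteq> 0" by linarith
  then have "(real T + 1) * \<epsilon> = e / 2"
    unfolding \<epsilon>_def by (metis nonzero_eq_divide_eq mult.commute)
  then have "e / 2 = (\<Sum>t=0..T. (if t = t0 then e else 0) - \<epsilon>)"
    using t0(1) by (simp add: sum_subtractf sum.delta algebra_simps)
  also have "\<dots> \<le> (\<Sum>t=0..T. p t (\<alpha> *\<^sub>R d t) / \<alpha>)"
    using \<alpha>(1) by (intro sum_mono less_imp_le)
  also have "\<dots> \<le> P0 / \<alpha>"
    using ray[OF \<alpha>(3)] \<alpha>(3) by (simp add: divide_right_mono flip: sum_divide_distrib)
  finally show False using \<alpha>(2) by simp
qed

subsection \<open>Utility of terminal wealth\<close>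

lemma open_less_if_upper_semicontinuous:
  "upper_semicontinuous f \<Longrightarrow> open {x. f x < c}"
  unfolding upper_semicontinuous_def
  by (subst open_subopen) (fastforce simp: eventually_nhds)

lemma borel_measurable_upper_semicontinuous:
  "upper_semicontinuous f \<Longrightarrow> f \<in> borel_measurable borel"
  by (rule borel_measurableI_less) (simp add: open_less_if_upper_semicontinuous)

lemma ennreal_diff_upper_semicontinuous_le_liminf:
  fixes y :: "nat \<Rightarrow> 'a::topological_space"
  assumes "upper_semicontinuous u" and "y \<longlonglongrightarrow> z"
  shows "ennreal (C - u z) \<le> liminf (\<lambda>n. ennreal (C - u (y n)))"
  unfolding le_Liminf_iff
proof (intro allI impI)
  fix a assume a: "a < ennreal (C - u z)"
  then obtain r where r: "a = ennreal r" "0 \<le> r" by (cases a) auto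
  then have "u z < C - r" using a by (simp add: ennreal_less_iff)
  then have "\<forall>\<^sub>F x in nhds z. u x < C - r"
    using assms(1) by (simp add: upper_semicontinuous_def)
  with assms(2) have "\<forall>\<^sub>F n in sequentially. u (y n) < C - r"
    by (rule eventually_compose_filterlim[rotated])
  then show "\<forall>\<^sub>F n in sequentially. a < ennreal (C - u (y n))"
    by eventually_elim (simp add: r ennreal_less_iff)
qed

lemma liminf_ennreal_eq_top:
  assumes "filterlim f at_top sequentially"
  shows "liminf (\<lambda>n. ennreal (f n)) = \<top>"
proof -
  have "\<top> \<le> liminf (\<lambda>n. ennreal (f n))"
    unfolding le_Liminf_iff
  proof (intro allI impI)
    fix a :: ennreal assume "a < \<top>"
    then obtain r where r: "a = ennreal r" "0 \<le> r" by (cases a) auto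
    have "\<forall>\<^sub>F n in sequentially. r < f n" using assms by (simp add: filterlim_at_top_dense)
    then show "\<forall>\<^sub>F n in sequentially. a < ennreal (f n)"
      by eventually_elim (simp add: r ennreal_less_iff)
  qed
  then show ?thesis by (simp add: top_unique)
qed

text \<open>This turns unbounded costs into unbounded losses. The growth condition at -1 bounds
  \<open>u\<close> by a line of slope \<open>- b > 0\<close> far to the left, and boundedness from
  above controls the rest.\<close>

lemma utility_le_affine:
  fixes u :: "real \<Rightarrow> real"
  assumes bdd: "bdd_above (range u)" and slope: "Limsup at_top (\<lambda>\<alpha>. ereal (u (\<alpha> * - 1) / \<alpha>)) < 0"
  shows "\<exists>c k. 0 < c \<and> (\<forall>y. u y \<le> k + c * y)"
proof -
  obtain C where C: "\<And>y. u y \<le> C" using bdd by (auto simp: bdd_above_def)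
  obtain b where b: "Limsup at_top (\<lambda>\<alpha>. ereal (u (\<alpha> * - 1) / \<alpha>)) < ereal b" "ereal b < 0"
    using ereal_dense2[OF slope] by blast
  have "\<forall>\<^sub>F \<alpha> in at_top. u (- \<alpha>) / \<alpha> < b"
    using Limsup_lessD[OF b(1)] by simp
  then obtain A0 where A0: "\<And>\<alpha>. A0 \<le> \<alpha> \<Longrightarrow> u (- \<alpha>) / \<alpha> < b"
    by (auto simp: eventually_at_top_linorder)
  define A where "A = max 1 A0"
  have A: "1 \<le> A" "A0 \<le> A" by (auto simp: A_def)
  \<comment> \<open>The constant is nonnegative, so it does no harm for \<open>y \<le> - A\<close>;
    to the right of \<open>- A\<close> the bound equals |C| plus the nonnegative term
    \<open>- b * (y + A)\<close>.\<close>
  have "u y \<le> (\<bar>C\<bar> - b * A) + - b * y" for y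
  proof (cases "y \<le> - A")
    case True
    then have "u y < - b * y"
      using A0[of "- y"] A by (simp add: field_simps)
    moreover have "b * A \<le> 0" using b(2) A by (simp add: mult_le_0_iff)
    ultimately show ?thesis by simp
  next
    case False
    then have "0 \<le> - b * (y + A)" using b(2) by (intro mult_nonneg_nonneg) auto
    then show ?thesis using C[of y] by (simp add: algebra_simps)
  qed
  then show ?thesis using b(2) by (intro exI[of _ "- b"] exI[of _ "\<bar>C\<bar> - b * A"]) auto
qed

text \<open>Maximising expected utility thereby becomes minimising a nonnegative integral. The
  positive part of C - Y plus that of Y equals C plus the negative part of Y, an identity free of
  subtraction that can be integrated even if values are infinite. It can be rearranged because the
  positive part of \<open>Y\<close> has finite integral.\<close>

lemma (in prob_space) extended_expectation_eq:
  assumes [measurable]: "Y \<in> borel_measurable M" and le: "\<And>\<omega>. \<omega> \<in> space M \<Longrightarrow> Y \<omega> \<le> C" and C: "0 \<le> C"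
  shows "extended_expectation M Y = ereal C - enn2ereal (\<integral>\<^sup>+ \<omega>. ennreal (C - Y \<omega>) \<partial>M)"
proof -
  define P where "P = (\<integral>\<^sup>+ \<omega>. ennreal (Y \<omega>) \<partial>M)"
  define N where "N = (\<integral>\<^sup>+ \<omega>. ennreal (- Y \<omega>) \<partial>M)"
  define L where "L = (\<integral>\<^sup>+ \<omega>. ennreal (C - Y \<omega>) \<partial>M)"
  have const: "(\<integral>\<^sup>+ \<omega>. ennreal C \<partial>M) = ennreal C" by (simp add: emeasure_space_1)
  have "ennreal (C - Y \<omega>) + ennreal (Y \<omega>) = ennreal C + ennreal (- Y \<omega>)" if "\<omega> \<in> space M" for \<omega>
    using le[OF that] C by (cases "0 \<le> Y \<omega>") (auto simp: ennreal_neg simp flip: ennreal_plus)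
  then have "(\<integral>\<^sup>+ \<omega>. ennreal (C - Y \<omega>) + ennreal (Y \<omega>) \<partial>M) = (\<integral>\<^sup>+ \<omega>. ennreal C + ennreal (- Y \<omega>) \<partial>M)"
    by (rule nn_integral_cong)
  then have eq: "L + P = ennreal C + N"
    unfolding L_def P_def N_def by (simp add: nn_integral_add emeasure_space_1)
  have "P \<le> (\<integral>\<^sup>+ \<omega>. ennreal C \<partial>M)"
    unfolding P_def by (intro nn_integral_mono ennreal_leI le)
  also note const
  finally obtain p where p: "P = ennreal p" "0 \<le> p" by (cases P) (auto simp: top_unique)
  have "enn2ereal P - enn2ereal N = ereal C - enn2ereal L"
  proof (cases N)
    case top
    then have "L = \<top>" using eq p by simp
    then show ?thesis using top p by (simp add: top_ereal_def)
  next
    case (real n)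
    then have "L \<noteq> \<top>" using eq C by (auto simp flip: ennreal_plus)
    then obtain l where l: "L = ennreal l" "0 \<le> l" by (cases L) auto
    have "l + p = C + n" using eq real p l C by (simp flip: ennreal_plus)
    then show ?thesis using real p l by (simp add: enn2ereal_ennreal)
  qed
  then show ?thesis by (simp add: extended_expectation_def P_def N_def L_def)
qed

text \<open>\<open>X t\<close> is chosen at time \<open>t\<close> and held over \<open>(t, t + 1]\<close>, so it is the entry of the strategy at \<open>t + 1\<close>.\<close>

definition holdings :: "nat \<Rightarrow> (nat \<Rightarrow> 'w \<Rightarrow> 'a::zero) \<Rightarrow> nat \<Rightarrow> 'w \<Rightarrow> 'a" where
  "holdings T X t \<omega> = (if 1 \<le> t \<and> t \<le> T then X (t - 1) \<omega> else 0)"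

lemma sum_trades: "(\<Sum>t=0..i. holdings T X (t + 1) \<omega> - holdings T X t \<omega>) = holdings T X (i + 1) \<omega>"
  for X :: "nat \<Rightarrow> 'w \<Rightarrow> 'a::ab_group_add"
  by (induction i) (simp_all add: holdings_def)

text \<open>Trades telescope, so a position is the sum of the trades that led to it; a diverging
  position forces the total size of the trades to diverge.\<close>

lemma norm_le_sum_norm_trades:
  fixes X :: "nat \<Rightarrow> 'w \<Rightarrow> 'a::real_normed_vector"
  assumes "i < T"
  shows "norm (X i \<omega>) \<le> (\<Sum>t=0..T. norm (holdings T X (t + 1) \<omega> - holdings T X t \<omega>))"
proof -
  have "norm (X i \<omega>) = norm (\<Sum>t=0..i. holdings T X (t + 1) \<omega> - holdings T X t \<omega>)"
    unfolding sum_trades using assms by (simp add: holdings_def)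
  also have "\<dots> \<le> (\<Sum>t=0..i. norm (holdings T X (t + 1) \<omega> - holdings T X t \<omega>))"
    by (rule norm_sum)
  also have "\<dots> \<le> (\<Sum>t=0..T. norm (holdings T X (t + 1) \<omega> - holdings T X t \<omega>))"
    using assms by (intro sum_mono2) auto
  finally show ?thesis .
qed

lemma normal_integrand_measurable_compose:
  assumes "normal_integrand N G" and N: "subalgebra M N" and [measurable]: "f \<in> borel_measurable M"
  shows "(\<lambda>\<omega>. G (f \<omega>) \<omega>) \<in> borel_measurable M"
proof -
  have [measurable]: "(\<lambda>\<omega>. \<omega>) \<in> measurable M N"
    by (rule measurable_from_subalg[OF N measurable_ident[unfolded id_def]])
  have "(\<lambda>\<omega>. (f \<omega>, \<omega>)) \<in> measurable M (borel \<Otimes>\<^sub>M N)" by measurable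
  moreover have "(\<lambda>(x, \<omega>). G x \<omega>) \<in> borel_measurable (borel \<Otimes>\<^sub>M N)"
    using assms(1) by (simp add: normal_integrand_def)
  ultimately show ?thesis using measurable_compose by fastforce
qed

theorem theorem8:
  fixes M :: "'w measure" and F :: "nat \<Rightarrow> 'w measure" and T :: nat
    and Z :: "nat \<Rightarrow> 'w \<Rightarrow> real ^ 'n"
    and G :: "nat \<Rightarrow> real ^ 'n \<Rightarrow> 'w \<Rightarrow> real"
    and W :: "'w \<Rightarrow> real" and u :: "real \<Rightarrow> real" and x0 :: real
  assumes "complete_filtered_prob_space M F T"
    and Z_adapted: "\<And>t. t \<le> T \<Longrightarrow> Z t \<in> borel_measurable (F t)"
    and G_normal: "\<And>t. t \<le> T \<Longrightarrow> normal_integrand (F t) (G t)"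
    and G_nonneg: "\<And>t z \<omega>. t \<le> T \<Longrightarrow> \<omega> \<in> space M \<Longrightarrow> 0 \<le> G t z \<omega>"
    and G_convex: "\<And>t. t \<le> T \<Longrightarrow> AE \<omega> in M. convex_on UNIV (\<lambda>z. G t z \<omega>)"
    and G_slope: "\<And>t. t \<le> T \<Longrightarrow>
      AE \<omega> in M. \<forall>z. asymptotic_slope (\<lambda>x. G t x \<omega>) z \<ge> ereal (- (Z t \<omega> \<bullet> z))"
    and G_slope_strict: "\<And>t. t \<le> T \<Longrightarrow>
      AE \<omega> in M. \<forall>z. z \<notin> nonpos_orthant \<longrightarrow>
        asymptotic_slope (\<lambda>x. G t x \<omega>) z > ereal (- (Z t \<omega> \<bullet> z))"
    and W_rv: "W \<in> borel_measurable M"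
    and u_usc: "upper_semicontinuous u"
    and u_bdd: "bdd_above (range u)"
    and u_slope: "\<And>w. w < 0 \<Longrightarrow> Limsup at_top (\<lambda>\<alpha>. ereal (u (\<alpha> * w) / \<alpha>)) < 0"
  shows "\<exists>\<phi>' \<in> trading_strategies M F T.
    (SUP \<phi> \<in> trading_strategies M F T.
       extended_expectation M (\<lambda>\<omega>. u (terminal_cash x0 Z G T \<phi> \<omega> + W \<omega>))) =
    extended_expectation M (\<lambda>\<omega>. u (terminal_cash x0 Z G T \<phi>' \<omega> + W \<omega>))"
proof -
  interpret complete_filtered_prob_space M F T by fact
  have F_M: "subalgebra M (F t)" if "t \<le> T" for t using that by (rule subalgebra_F)
  have F_F: "subalgebra (F j) (F i)" if "i \<le> j" "j \<le> T" for i j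
    using F_M[of i] F_M[of j] sets_F_mono[OF that] that by (auto simp: subalgebra_def)
  note [measurable] = W_rv borel_measurable_upper_semicontinuous[OF u_usc]
  have [measurable]: "Z t \<in> borel_measurable M" if "t \<le> T" for t
    by (rule measurable_from_subalg[OF F_M[OF that] Z_adapted[OF that]])

  obtain C where C: "0 \<le> C" "\<And>y. u y \<le> C"
  proof -
    obtain B where "\<And>y. u y \<le> B" using u_bdd by (auto simp: bdd_above_def)
    then show ?thesis by (intro that[of "max 0 B"]) (auto simp: le_max_iff_disj)
  qed
  obtain c k where c: "0 < c" "\<And>y. u y \<le> k + c * y"
    using utility_le_affine[OF u_bdd u_slope] by auto

  define wealth where "wealth \<phi> \<omega> = terminal_cash x0 Z G T \<phi> \<omega> + W \<omega>" for \<phi> \<omega>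
  have meas_wealth: "wealth \<phi> \<in> borel_measurable M"
    if \<phi>: "\<And>t. t \<le> T + 1 \<Longrightarrow> \<phi> t \<in> borel_measurable M" for \<phi>
  proof -
    have [measurable]: "\<phi> t \<in> borel_measurable M" "\<phi> (t + 1) \<in> borel_measurable M" if "t \<le> T" for t
      using that by (auto intro!: \<phi>)
    have [measurable]: "(\<lambda>\<omega>. G t (\<phi> (t + 1) \<omega> - \<phi> t \<omega>) \<omega>) \<in> borel_measurable M" if "t \<le> T" for t
      by (rule normal_integrand_measurable_compose[OF G_normal[OF that] F_M[OF that]]) (use that in measurable)
    show ?thesis
      unfolding wealth_def terminal_cash_def by measurable
  qed
  define J where "J X \<omega> = ennreal (C - u (wealth (holdings T X) \<omega>))" for X \<omega>
  have ae: "AE \<omega> in M. \<forall>t\<in>{0..T}. convex_on UNIV (\<lambda>z. G t z \<omega>) \<and>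
      (\<forall>z. ereal (- (Z t \<omega> \<bullet> z)) \<le> asymptotic_slope (\<lambda>x. G t x \<omega>) z) \<and>
      (\<forall>z. z \<notin> nonpos_orthant \<longrightarrow> ereal (- (Z t \<omega> \<bullet> z)) < asymptotic_slope (\<lambda>x. G t x \<omega>) z)"
    using G_convex G_slope G_slope_strict by (intro AE_finite_allI) auto
  \<comment> \<open>The endowment is measurable only for \<open>M\<close>, so \<open>M\<close>
    itself is the initial information; filtering down to the \<open>F i\<close> is left to the
    backward induction.\<close>
  have "coercive_lsc M M T J"
    unfolding coercive_lsc_def
  proof (intro conjI ballI allI impI)
    fix X :: "nat \<Rightarrow> 'w \<Rightarrow> real ^ 'n" assume X: "X \<in> tuples M T"
    have "holdings T X t \<in> borel_measurable M" for t
    proof (cases "1 \<le> t \<and> t \<le> T")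
      case True
      then show ?thesis using X by (auto simp: tuples_def holdings_def[abs_def])
    next
      case False
      then have "holdings T X t = (\<lambda>_. 0)" by (auto simp: holdings_def)
      then show ?thesis by simp
    qed
    then have [measurable]: "wealth (holdings T X) \<in> borel_measurable M" by (rule meas_wealth)
    show "J X \<in> borel_measurable M" unfolding J_def by measurable
  next
    fix Y :: "nat \<Rightarrow> nat \<Rightarrow> 'w \<Rightarrow> real ^ 'n" and X :: "nat \<Rightarrow> 'w \<Rightarrow> real ^ 'n"
    show "AE \<omega> in M. (\<forall>i<T. (\<lambda>n. Y n i \<omega>) \<longlonglongrightarrow> X i \<omega>) \<longrightarrow> J X \<omega> \<le> liminf (\<lambda>n. J (Y n) \<omega>)"
      using ae
    proof eventually_elim
      case (elim \<omega>)
      show ?case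
      proof
        assume lim: "\<forall>i<T. (\<lambda>n. Y n i \<omega>) \<longlonglongrightarrow> X i \<omega>"
        have hold: "(\<lambda>n. holdings T (Y n) t \<omega>) \<longlonglongrightarrow> holdings T X t \<omega>" for t
          using lim by (auto simp: holdings_def)
        \<comment> \<open>A finite convex function on a Euclidean space is continuous. Wealth is
          thus continuous in the holdings, and only \<open>u\<close> contributes mere
          semicontinuity.\<close>
        have "isCont (\<lambda>z. G t z \<omega>) z" if "t \<in> {0..T}" for t z
          using convex_on_continuous[OF open_UNIV, of "\<lambda>z. G t z \<omega>"] elim that
          by (simp add: continuous_on_eq_continuous_at)
        then have "(\<lambda>n. wealth (holdings T (Y n)) \<omega>) \<longlonglongrightarrow> wealth (holdings T X) \<omega>"
          unfolding wealth_def terminal_cash_def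
          by (intro tendsto_intros tendsto_sum hold isCont_tendsto_compose[where g = "\<lambda>z. G _ z \<omega>"])
        then show "J X \<omega> \<le> liminf (\<lambda>n. J (Y n) \<omega>)"
          unfolding J_def by (rule ennreal_diff_upper_semicontinuous_le_liminf[OF u_usc])
      qed
    qed
  next
    fix Y :: "nat \<Rightarrow> nat \<Rightarrow> 'w \<Rightarrow> real ^ 'n"
    show "AE \<omega> in M. (\<exists>i<T. filterlim (\<lambda>n. norm (Y n i \<omega>)) at_top sequentially) \<longrightarrow>
        liminf (\<lambda>n. J (Y n) \<omega>) = \<top>"
      using ae
    proof eventually_elim
      case (elim \<omega>)
      show ?case
      proof
        assume "\<exists>i<T. filterlim (\<lambda>n. norm (Y n i \<omega>)) at_top sequentially"
        then obtain i where i: "i < T" "filterlim (\<lambda>n. norm (Y n i \<omega>)) at_top sequentially" by blast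
        define D where "D n t = holdings T (Y n) (t + 1) \<omega> - holdings T (Y n) t \<omega>" for n t
        have D_norm: "filterlim (\<lambda>n. \<Sum>t=0..T. norm (D n t)) at_top sequentially"
          unfolding D_def
          by (intro filterlim_at_top_mono[OF i(2)] always_eventually allI norm_le_sum_norm_trades i(1))
        have D_sum: "(\<Sum>t=0..T. D n t) = 0" for n
          unfolding D_def sum_trades by (simp add: holdings_def)
        define cost where "cost n = (\<Sum>t=0..T. D n t \<bullet> Z t \<omega> + G t (D n t) \<omega>)" for n
        have "filterlim cost at_top sequentially"
          unfolding cost_def
          by (rule trading_cost_coercive[where g = "\<lambda>t z. G t z \<omega>" and Z = "\<lambda>t. Z t \<omega>", OF _ _ _ D_sum D_norm])
            (use elim in auto)
        \<comment> \<open>The affine bound on \<open>u\<close>, evaluated at wealth x0 + W - cost.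
          On a fixed path the endowment is a constant, so it cannot offset diverging costs.\<close>
        then have "filterlim (\<lambda>n. (C - k - c * (x0 + W \<omega>)) + c * cost n) at_top sequentially"
          by (intro filterlim_tendsto_add_at_top[OF tendsto_const]
              filterlim_tendsto_pos_mult_at_top[OF tendsto_const c(1)])
        moreover have "(C - k - c * (x0 + W \<omega>)) + c * cost n \<le> C - u (wealth (holdings T (Y n)) \<omega>)" for n
        proof -
          have eq: "wealth (holdings T (Y n)) \<omega> = x0 + W \<omega> - cost n"
            by (simp add: wealth_def terminal_cash_def cost_def D_def sum.distrib)
          show ?thesis
            unfolding eq using c(2)[of "x0 + W \<omega> - cost n"] by (simp add: algebra_simps)
        qed
        ultimately have "filterlim (\<lambda>n. C - u (wealth (holdings T (Y n)) \<omega>)) at_top sequentially"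
          by (elim filterlim_at_top_mono) auto
        then show "liminf (\<lambda>n. J (Y n) \<omega>) = \<top>"
          unfolding J_def by (rule liminf_ennreal_eq_top)
      qed
    qed
  qed
  moreover have "subalgebra M M" by (simp add: subalgebra_def)
  ultimately have "\<exists>X. (\<forall>i<T. X i \<in> borel_measurable (F i)) \<and>
    (\<forall>Y. (\<forall>i<T. Y i \<in> borel_measurable (F i)) \<longrightarrow> (\<integral>\<^sup>+ \<omega>. J X \<omega> \<partial>M) \<le> (\<integral>\<^sup>+ \<omega>. J Y \<omega> \<partial>M))"
    by (intro adapted_minimizer[where N = M] F_M F_F) (auto intro: prob_space_axioms)
  then obtain X where X: "\<And>i. i < T \<Longrightarrow> X i \<in> borel_measurable (F i)"
    and opt: "\<And>Y. (\<And>i. i < T \<Longrightarrow> Y i \<in> borel_measurable (F i)) \<Longrightarrow> (\<integral>\<^sup>+ \<omega>. J X \<omega> \<partial>M) \<le> (\<integral>\<^sup>+ \<omega>. J Y \<omega> \<partial>M)"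
    by blast
  have hold_X: "holdings T X \<in> trading_strategies M F T"
  proof -
    have "holdings T X t \<in> borel_measurable (F (t - 1))" if "t \<in> {1..T + 1}" for t
    proof (cases "t \<le> T")
      case True
      then show ?thesis using X[of "t - 1"] that by (simp add: holdings_def[abs_def])
    next
      case False
      then have "holdings T X t = (\<lambda>_. 0)" by (auto simp: holdings_def)
      then show ?thesis by simp
    qed
    then show ?thesis by (auto simp: trading_strategies_def holdings_def)
  qed
  have expect: "extended_expectation M (\<lambda>\<omega>. u (wealth \<phi> \<omega>)) =
      ereal C - enn2ereal (\<integral>\<^sup>+ \<omega>. ennreal (C - u (wealth \<phi> \<omega>)) \<partial>M)"
    if \<phi>: "\<phi> \<in> trading_strategies M F T" for \<phi>
  proof (rule extended_expectation_eq)
    have "\<phi> t \<in> borel_measurable M" if "t \<le> T + 1" for t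
    proof (cases "t = 0")
      case True
      have "\<phi> 0 \<in> borel_measurable M \<longleftrightarrow> (\<lambda>_. 0 :: real ^ 'n) \<in> borel_measurable M"
        by (rule measurable_cong) (use \<phi> in \<open>auto simp: trading_strategies_def\<close>)
      then show ?thesis using True by simp
    next
      case False
      then show ?thesis
        using that \<phi> by (intro measurable_from_subalg[OF F_M[of "t - 1"]]) (auto simp: trading_strategies_def)
    qed
    then have [measurable]: "wealth \<phi> \<in> borel_measurable M" by (rule meas_wealth)
    show "(\<lambda>\<omega>. u (wealth \<phi> \<omega>)) \<in> borel_measurable M" by measurable
  qed (use C in auto)
  have "extended_expectation M (\<lambda>\<omega>. u (wealth \<phi> \<omega>)) \<le> extended_expectation M (\<lambda>\<omega>. u (wealth (holdings T X) \<omega>))"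
    if \<phi>: "\<phi> \<in> trading_strategies M F T" for \<phi>
  proof -
    \<comment> \<open>A strategy vanishes at times 0 and \<open>T + 1\<close> only on
      \<open>space M\<close>, so it agrees with the holdings rebuilt from its inner entries there
      and possibly not elsewhere; for the integrals this is enough.\<close>
    have hold: "holdings T (\<lambda>i. \<phi> (i + 1)) t \<omega> = \<phi> t \<omega>" if "t \<le> T + 1" "\<omega> \<in> space M" for t \<omega>
    proof -
      have "t = 0 \<or> t = T + 1 \<or> 1 \<le> t \<and> t \<le> T" using that(1) by auto
      then show ?thesis using \<phi> that(2) by (auto simp: trading_strategies_def holdings_def)
    qed
    have "(\<integral>\<^sup>+ \<omega>. J X \<omega> \<partial>M) \<le> (\<integral>\<^sup>+ \<omega>. J (\<lambda>i. \<phi> (i + 1)) \<omega> \<partial>M)"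
    proof (rule opt)
      fix i assume "i < T"
      then have "i + 1 \<in> {1..T + 1}" by simp
      then have "\<phi> (i + 1) \<in> borel_measurable (F (i + 1 - 1))"
        using \<phi> unfolding trading_strategies_def by blast
      then show "\<phi> (i + 1) \<in> borel_measurable (F i)" by simp
    qed
    also have "\<dots> = (\<integral>\<^sup>+ \<omega>. ennreal (C - u (wealth \<phi> \<omega>)) \<partial>M)"
      by (intro nn_integral_cong) (simp add: J_def wealth_def terminal_cash_def hold[simplified] cong: sum.cong_simp)
    finally show ?thesis
      unfolding expect[OF \<phi>] expect[OF hold_X] J_def
      by (intro ereal_minus_mono order_refl) (simp add: less_eq_ennreal.rep_eq)
  qed
  then show ?thesis
    using hold_X unfolding wealth_def by (intro bexI[OF _ hold_X] antisym SUP_least SUP_upper)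
qed

end
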